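(* Consider the online bipartite matching problem with distance weight $w(x,y)=\|x-y\|_2$ (defined in the context). For any $\epsilon\in(0,1)$ and $\delta\in(0,1)$ there is a randomized data structure using $\tilde O(\epsilon^{-2}nd\log(n/\delta))$ space that supports: (1) $\textsc{Init}(\{x_1,\dots,x_n\}\subseteq\mathbb{R}^d,\epsilon,\delta)$: takes the offline points $x_1,\dots,x_n$, a precision parameter $\epsilon$ and failure tolerance $\delta$, and runs in time $\tilde O(\epsilon^{-2}nd\log(n/\delta))$; (2) $\textsc{Update}(y\in\mathbb{R}^d)$: takes an online point $y$, matches it to an offline point, and runs in time $\tilde O(\epsilon^{-2}(n+d)\log(n/\delta))$; (3) $\textsc{Query}$: outputs in $O(1)$ time the value of the matching between the offline points and the online points received so far, such that this value is at least $\frac12(1-2\epsilon)\,\mathsf{opt}$ (competitive ratio $\frac12(1-2\epsilon)$) with probability at least $1-\delta$, where the number of online points is $n$.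
   Context: Online matching problem: offline points $x_1,\dots,x_n\in\mathbb{R}^d$ are known in advance; online points $y\in\mathbb{R}^d$ arrive one at a time (via \textsc{Update}), and each must be irrevocably matched to some offline point without knowledge of future online points. An offline point may be matched to several online points; the value of a matching is $\sum_{i}\max\{w(x_i,y): y \text{ matched to } x_i\}$ (a term is $0$ if $x_i$ has no partner). $\mathsf{opt}$ is the maximum value over all assignments of the received online points to offline points. $\tilde O(f)$ denotes $O(f\cdot\mathrm{poly}\log f)$. *)

theory Defs
  imports "HOL-Probability.Probability" "HOL-Library.Landau_Symbols"
begin

section \<open>A randomized real RAM\<close>

text \<open>
  Time and space are measured on a real RAM with fair coin flips, programmed in a small
  structured language.  The memory consists of a bank of natural numbers (used for indexing) and
  a bank of exact real numbers; both are addressed by naturals.  The operands of the current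
  operation are presented in a separate random-access buffer, which programs cannot write to.
  There is no floor or other conversion from reals to naturals, and the only constants in a
  program text are natural numbers, so that no information can be hidden in a real constant.
\<close>

record store =
  icell :: "nat \<Rightarrow> nat"
  rcell :: "nat \<Rightarrow> real"
  input :: "nat \<Rightarrow> real"

datatype iexp =
    IConst nat
  | ICell iexp
  | IAdd iexp iexp
  | ISub iexp iexp
  | IMul iexp iexp

datatype rexp =
    RNat iexp
  | RCell iexp
  | RInput iexp
  | RAdd rexp rexp
  | RSub rexp rexp
  | RMul rexp rexp
  | RDiv rexp rexp
  | RSqrt rexp

datatype test =
    ILess iexp iexp
  | RLess rexp rexp
  | TNot test
  | TAnd test test

datatype com =
    Skip
  | ISet iexp iexp
  | RSet iexp rexp
  | Flip iexp
  | Seq com com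
  | If test com com
  | While test com

primrec ival :: "iexp \<Rightarrow> store \<Rightarrow> nat" where
  "ival (IConst k) s = k"
| "ival (ICell a) s = icell s (ival a s)"
| "ival (IAdd a b) s = ival a s + ival b s"
| "ival (ISub a b) s = ival a s - ival b s"
| "ival (IMul a b) s = ival a s * ival b s"

primrec rval :: "rexp \<Rightarrow> store \<Rightarrow> real" where
  "rval (RNat a) s = real (ival a s)"
| "rval (RCell a) s = rcell s (ival a s)"
| "rval (RInput a) s = input s (ival a s)"
| "rval (RAdd e f) s = rval e s + rval f s"
| "rval (RSub e f) s = rval e s - rval f s"
| "rval (RMul e f) s = rval e s * rval f s"
| "rval (RDiv e f) s = rval e s / rval f s"
| "rval (RSqrt e) s = sqrt (rval e s)"

primrec holds :: "test \<Rightarrow> store \<Rightarrow> bool" where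
  "holds (ILess a b) s \<longleftrightarrow> ival a s < ival b s"
| "holds (RLess e f) s \<longleftrightarrow> rval e s < rval f s"
| "holds (TNot t) s \<longleftrightarrow> \<not> holds t s"
| "holds (TAnd t u) s \<longleftrightarrow> holds t s \<and> holds u s"

text \<open>
  One small step of a program has cost one.  A program text is fixed once and for all, so
  evaluating an expression occurring in it takes a constant number of elementary operations, and
  the number of steps agrees with the number of elementary operations up to a constant factor.
  A program has halted when it has become \<^term>\<open>Skip\<close>.
\<close>

primrec step :: "com \<Rightarrow> store \<Rightarrow> (com \<times> store) pmf" where
  "step Skip s = return_pmf (Skip, s)"
| "step (ISet a e) s =
     return_pmf (Skip, s\<lparr>icell := (icell s)(ival a s := ival e s)\<rparr>)"
| "step (RSet a e) s =
     return_pmf (Skip, s\<lparr>rcell := (rcell s)(ival a s := rval e s)\<rparr>)"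
| "step (Flip a) s =
     map_pmf (\<lambda>b. (Skip, s\<lparr>icell := (icell s)(ival a s := of_bool b)\<rparr>)) (bernoulli_pmf (1/2))"
| "step (Seq c1 c2) s =
     (if c1 = Skip then return_pmf (c2, s)
      else map_pmf (\<lambda>(c1', s'). (Seq c1' c2, s')) (step c1 s))"
| "step (If t c1 c2) s = return_pmf (if holds t s then c1 else c2, s)"
| "step (While t c) s = return_pmf (if holds t s then Seq c (While t c) else Skip, s)"

definition run :: "nat \<Rightarrow> com \<Rightarrow> store \<Rightarrow> (com \<times> store) pmf" where
  "run t c s = ((\<lambda>M. bind_pmf M (\<lambda>(c', s'). step c' s')) ^^ t) (return_pmf (c, s))"

text \<open>Worst-case running time: the bound holds for every outcome of the coin flips.\<close>

definition halts_within :: "nat \<Rightarrow> com \<Rightarrow> store \<Rightarrow> bool" where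
  "halts_within t c s \<longleftrightarrow> (\<forall>(c', s') \<in> set_pmf (run t c s). c' = Skip)"

text \<open>
  The distribution of the final store; meaningful if \<^term>\<open>halts_within t c s\<close> for some
  \<^term>\<open>t\<close>, and then independent of the choice of that \<^term>\<open>t\<close>.
\<close>

definition final :: "com \<Rightarrow> store \<Rightarrow> store pmf" where
  "final c s = map_pmf snd (run (LEAST t. halts_within t c s) c s)"

text \<open>
  Space is the size of the address range in use.  As usual for a RAM, the naturals stored are
  required to be of the magnitude of the addresses, so that a cell cannot hold a large
  data structure packed into one number.
\<close>

definition fits :: "nat \<Rightarrow> store \<Rightarrow> bool" where
  "fits S s \<longleftrightarrow> (\<forall>a. icell s a < S) \<and> (\<forall>a\<ge>S. icell s a = 0 \<and> rcell s a = 0)"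

definition runs_in_space :: "nat \<Rightarrow> com \<Rightarrow> store \<Rightarrow> bool" where
  "runs_in_space S c s \<longleftrightarrow> (\<forall>t. \<forall>(c', s') \<in> set_pmf (run t c s). fits S s')"


section \<open>Data structures for online matching\<close>

text \<open>
  A data structure is a triple of programs, the same for all \<open>n\<close>, \<open>d\<close>, \<open>\<epsilon>\<close>, \<open>\<delta>\<close>.  Points of
  \<open>d\<close>-dimensional Euclidean space are lists of length \<open>d\<close>.
\<close>

record data_structure =
  init_op :: com
  update_op :: com
  query_op :: com

datatype request = Update "real list" | Query

definition buffer :: "real list \<Rightarrow> nat \<Rightarrow> real" where
  "buffer l = (\<lambda>a. if a < length l then l ! a else 0)"

text \<open>
  Initialization starts from an empty memory, with \<open>n\<close> and \<open>d\<close> in the first two natural cells and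
  with \<open>\<epsilon>\<close>, \<open>\<delta>\<close> and the coordinates of the offline points in the input buffer.
\<close>

definition init_store :: "nat \<Rightarrow> nat \<Rightarrow> real \<Rightarrow> real \<Rightarrow> real list list \<Rightarrow> store" where
  "init_store n d \<epsilon> \<delta> xs =
     \<lparr>icell = (\<lambda>_. 0)(0 := n, 1 := d), rcell = (\<lambda>_. 0), input = buffer (\<epsilon> # \<delta> # concat xs)\<rparr>"

definition update_store :: "real list \<Rightarrow> store \<Rightarrow> store" where
  "update_store y s = s\<lparr>input := buffer y\<rparr>"

definition query_store :: "store \<Rightarrow> store" where
  "query_store s = s\<lparr>input := buffer []\<rparr>"

text \<open>
  On termination, an update has left the index of the offline point to which it matches \<open>y\<close> in
  the natural cell 0, and a query has left its answer in the real cell 0.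
\<close>

definition matched_index :: "store \<Rightarrow> nat" where
  "matched_index s = icell s 0"

definition answer :: "store \<Rightarrow> real" where
  "answer s = rcell s 0"

text \<open>
  A session keeps the list of the indices announced by the updates so far (the matching) next to
  the memory of the data structure.  Announced indices are never revised.
\<close>

fun serve ::
  "data_structure \<Rightarrow> request \<Rightarrow> nat list \<times> store \<Rightarrow> (nat list \<times> store) pmf" where
  "serve D (Update y) (is, s) =
     map_pmf (\<lambda>s'. (is @ [matched_index s'], s')) (final (update_op D) (update_store y s))"
| "serve D Query (is, s) =
     map_pmf (\<lambda>s'. (is, s')) (final (query_op D) (query_store s))"

definition session ::
  "data_structure \<Rightarrow> nat \<Rightarrow> nat \<Rightarrow> real \<Rightarrow> real \<Rightarrow> real list list \<Rightarrow> request list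
     \<Rightarrow> (nat list \<times> store) pmf" where
  "session D n d \<epsilon> \<delta> xs rs =
     fold (\<lambda>r M. bind_pmf M (serve D r)) rs
       (map_pmf (\<lambda>s. ([], s)) (final (init_op D) (init_store n d \<epsilon> \<delta> xs)))"

definition query_answer :: "data_structure \<Rightarrow> store \<Rightarrow> real pmf" where
  "query_answer D s = map_pmf answer (final (query_op D) (query_store s))"

fun online_points :: "request list \<Rightarrow> real list list" where
  "online_points [] = []"
| "online_points (Update y # rs) = y # online_points rs"
| "online_points (Query # rs) = online_points rs"


section \<open>Values of matchings\<close>

definition weight :: "real list \<Rightarrow> real list \<Rightarrow> real" where
  "weight x y = L2_set (\<lambda>k. x ! k - y ! k) {..<length x}"

text \<open>An assignment \<open>is\<close> matches the online point \<open>ys ! t\<close> to the offline point \<open>xs ! (is ! t)\<close>.\<close>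

definition assignments :: "nat \<Rightarrow> nat \<Rightarrow> nat list set" where
  "assignments n m = {is. length is = m \<and> set is \<subseteq> {..<n}}"

definition partners :: "nat list \<Rightarrow> nat \<Rightarrow> nat set" where
  "partners is i = {t. t < length is \<and> is ! t = i}"

definition matching_value :: "real list list \<Rightarrow> real list list \<Rightarrow> nat list \<Rightarrow> real" where
  "matching_value xs ys is =
     (\<Sum>i<length xs. if partners is i = {} then 0
                    else Max ((\<lambda>t. weight (xs ! i) (ys ! t)) ` partners is i))"

definition opt :: "real list list \<Rightarrow> real list list \<Rightarrow> real" where
  "opt xs ys = Max (matching_value xs ys ` assignments (length xs) (length ys))"


section \<open>Resource bounds\<close>

text \<open>
  Parameters are quadruples \<open>(n, d, \<epsilon>, \<delta>)\<close>.  The O-bounds are uniform, i.e. they hold with one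
  constant for all parameters with \<open>n / \<delta> \<ge> 2\<close>; this is automatic for \<open>n \<ge> 2\<close>.  For \<open>n = 1\<close> and
  \<open>\<delta> \<rightarrow> 1\<close> the factor \<open>ln (n / \<delta>)\<close> tends to 0, and not even reading the input would be possible.
\<close>

type_synonym params = "nat \<times> nat \<times> real \<times> real"

definition valid_params :: "params set" where
  "valid_params = {(n, d, \<epsilon>, \<delta>). 1 \<le> n \<and> 1 \<le> d \<and> 0 < \<epsilon> \<and> \<epsilon> < 1 \<and> 0 < \<delta> \<and> \<delta> < 1}"

definition regime :: "params set" where
  "regime = {(n, d, \<epsilon>, \<delta>) \<in> valid_params. 2 \<le> real n / \<delta>}"

text \<open>
  The shift by 2 keeps the polylogarithmic factor away from 0 when \<^term>\<open>f p\<close> is close to 1;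
  it is immaterial for large \<^term>\<open>f p\<close>.
\<close>

definition soft_O :: "(params \<Rightarrow> real) \<Rightarrow> (params \<Rightarrow> real) set" where
  "soft_O f = (\<Union>k::nat. O[principal regime](\<lambda>p. f p * ln (2 + f p) ^ k))"

end

theory Submission
  imports Defs
begin

text \<open>
  The online points of a session are fixed before the coins are flipped, so a random sign matrix
  with \<open>m = O(\<epsilon>\<^sup>-\<^sup>2 ln (n/\<delta>))\<close> rows preserves all \<open>n\<^sup>2\<close> distances up to a factor \<open>1 \<plusminus> \<epsilon>\<close> with
  probability \<open>1 - \<delta>\<close>.  An update sketches \<open>y\<close> in \<open>O(m d)\<close> steps, estimates all \<open>n\<close> distances in
  \<open>O(m n)\<close> steps, takes the offline point of largest estimated gain, and computes only the distance
  to this one point exactly, so that the maintained value of the matching is exact.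

  For the competitive ratio, let \<open>v\<^sub>i\<close> be the current share of the offline point \<open>i\<close> in the value and
  let \<open>o\<^sub>i\<close> be its share in a competing assignment.  The sum of the excesses
  \<open>max 0 ((1 - 2 \<epsilon>) o\<^sub>i - v\<^sub>i)\<close> grows in each step by at most the gain of the greedy choice, hence it
  never exceeds the value itself, and \<open>(1 - 2 \<epsilon>) \<Sum> o\<^sub>i\<close> is at most twice the value.
\<close>

section \<open>Program evaluation\<close>

text \<open>The estimates err on one side only: dividing by \<open>real m * (1 + \<epsilon>)\<close>
  keeps them below the true distance, so the exact gain of the chosen point is at least its
  estimated gain, and the greedy comparison pays only for the lower error. Features of the machine
  shape the rest. Without logarithms, the number of rows is found by multiplying up powers of
  \<open>1 + \<epsilon>\<^sup>2 / 20\<close> until a union bound over \<open>2 * n * n\<close>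
  events is met; the tail bound is therefore stated with these powers instead of exponentials. The
  matrix stays unchanged in memory and can be read back from any later store: almost everything is
  proved separately for each outcome of the coins, with competitiveness conditional on the accuracy
  of the stored matrix, and probability enters only through the uniform law of that matrix. Since
  \<open>final\<close> refers to the least halting time, a big-step relation carrying time bound,
  space bound and result distribution at once takes its place. For \<open>\<epsilon>\<close> above
  1/2 the claimed ratio is negative, hence the truncated factor
  \<open>max 0 (1 - 2 * \<epsilon>)\<close>.\<close>

lemma run_0: "run 0 c s = return_pmf (c, s)"
  by (simp add: run_def)

lemma run_Suc_end: "run (Suc t) c s = bind_pmf (run t c s) (\<lambda>(c', s'). step c' s')"
  by (simp add: run_def)

text \<open>The definition appends steps at the end, whereas programs are analysed by peeling off
  the first step.\<close>

lemma run_Suc: "run (Suc t) c s = bind_pmf (step c s) (\<lambda>(c', s'). run t c' s')"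
proof (induction t)
  case 0
  show ?case by (simp add: run_Suc_end run_0 bind_return_pmf split_def bind_return_pmf')
next
  case (Suc t)
  have "run (Suc (Suc t)) c s = bind_pmf (run (Suc t) c s) (\<lambda>(c', s'). step c' s')"
    by (rule run_Suc_end)
  also have "\<dots> = bind_pmf (step c s) (\<lambda>(c', s'). run (Suc t) c' s')"
    unfolding Suc by (simp add: run_Suc_end bind_assoc_pmf split_def)
  finally show ?case .
qed

lemma run_Skip: "run t Skip s = return_pmf (Skip, s)"
  by (induction t) (simp_all add: run_0 run_Suc bind_return_pmf)

lemma run_after_halt:
  assumes "halts_within t c s"
  shows "run (t + k) c s = run t c s"
proof (induction k)
  case (Suc k)
  have "run (t + Suc k) c s = bind_pmf (run t c s) (\<lambda>(c', s'). step c' s')"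
    by (simp add: run_Suc_end Suc)
  also have "\<dots> = bind_pmf (run t c s) return_pmf"
    using assms by (intro bind_pmf_cong) (auto simp: halts_within_def)
  finally show ?case by (simp add: bind_return_pmf')
qed simp

text \<open>A big-step view of the small-step semantics: \<open>t\<close> is only an upper bound on
  the steps (\<open>halt\<close> admits any \<open>t\<close>), and every store on the way must fit
  into \<open>S\<close>. The continuation \<open>G\<close> may depend on the outcome of a step, as a
  coin flip requires.\<close>

inductive evaluates :: "nat \<Rightarrow> nat \<Rightarrow> com \<Rightarrow> store \<Rightarrow> store pmf \<Rightarrow> bool" for S where
  halt: "fits S s \<Longrightarrow> evaluates S t Skip s (return_pmf s)"
| move: "\<lbrakk>c \<noteq> Skip; fits S s; \<And>c' s'. (c', s') \<in> set_pmf (step c s) \<Longrightarrow> evaluates S t c' s' (G c' s')\<rbrakk>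
    \<Longrightarrow> evaluates S (Suc t) c s (bind_pmf (step c s) (\<lambda>(c', s'). G c' s'))"

lemma evaluates_run: "evaluates S t c s M \<Longrightarrow> run t c s = map_pmf (Pair Skip) M"
proof (induction rule: evaluates.induct)
  case (move c s t G)
  have "bind_pmf (step c s) (\<lambda>(c', s'). run t c' s') =
      bind_pmf (step c s) (\<lambda>(c', s'). map_pmf (Pair Skip) (G c' s'))"
    using move by (intro bind_pmf_cong) auto
  then show ?case by (simp add: run_Suc map_bind_pmf split_def)
qed (simp add: run_Skip)

lemma evaluates_halts: "evaluates S t c s M \<Longrightarrow> halts_within t c s"
  by (auto simp: halts_within_def evaluates_run)

lemma evaluates_final:
  assumes "evaluates S t c s M"
  shows "final c s = M"
proof -
  let ?l = "LEAST t. halts_within t c s"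
  have h: "halts_within t c s" using assms by (rule evaluates_halts)
  then have l: "halts_within ?l c s" by (rule LeastI)
  have "?l \<le> t" using h by (rule Least_le)
  then have "run ?l c s = run t c s" using run_after_halt[OF l, of "t - ?l"] by simp
  then show ?thesis by (simp add: final_def evaluates_run[OF assms] pmf.map_comp o_def)
qed

lemma evaluates_fits_run:
  "evaluates S t c s M \<Longrightarrow> (c', s') \<in> set_pmf (run k c s) \<Longrightarrow> fits S s'"
proof (induction arbitrary: k c' s' rule: evaluates.induct)
  case (move c s t G)
  show ?case
  proof (cases k)
    case 0
    then show ?thesis using move by (simp add: run_0)
  next
    case (Suc l)
    then show ?thesis using move.IH move.prems by (fastforce simp: run_Suc)
  qed
qed (simp add: run_Skip)

lemma evaluates_space: "evaluates S t c s M \<Longrightarrow> runs_in_space S c s"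
  unfolding runs_in_space_def using evaluates_fits_run by blast

lemma evaluates_fits_result: "evaluates S t c s M \<Longrightarrow> s' \<in> set_pmf M \<Longrightarrow> fits S s'"
  by (induction rule: evaluates.induct) auto

lemma evaluates_mono: "evaluates S t c s M \<Longrightarrow> t \<le> t' \<Longrightarrow> evaluates S t' c s M"
proof (induction arbitrary: t' rule: evaluates.induct)
  case (move c s t G)
  then obtain u where "t' = Suc u" "t \<le> u" by (cases t') auto
  then show ?case using move by (auto intro: evaluates.move)
qed (auto intro: evaluates.halt)

text \<open>The extra 1 pays for the step from \<open>Seq Skip c2\<close> to
  \<open>c2\<close>.\<close>

lemma evaluates_Seq:
  assumes "evaluates S t c s M" "\<And>s'. s' \<in> set_pmf M \<Longrightarrow> evaluates S u c2 s' (G s')"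
  shows "evaluates S (t + u + 1) (Seq c c2) s (bind_pmf M G)"
  using assms
proof (induction rule: evaluates.induct)
  case (halt s t)
  have "evaluates S (Suc (t + u)) (Seq Skip c2) s (bind_pmf (step (Seq Skip c2) s) (\<lambda>(_, s'). G s'))"
    using halt by (intro evaluates.move) (auto intro: evaluates_mono)
  then show ?case by (simp add: bind_return_pmf)
next
  case (move c s t H)
  \<comment> \<open>A step of a \<open>Seq\<close> leaves a residual \<open>Seq c1 c2\<close>; the
    \<open>case\<close> recovers \<open>c1\<close>, whose result distribution is then continued by
    \<open>G\<close>.\<close>
  have "evaluates S (Suc (t + u + 1)) (Seq c c2) s (bind_pmf (step (Seq c c2) s)
     (\<lambda>(c', s'). case c' of Seq c1 c2 \<Rightarrow> bind_pmf (H c1 s') G))"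
  proof (rule evaluates.move)
    fix c' s' assume "(c', s') \<in> set_pmf (step (Seq c c2) s)"
    then obtain c1 where c1: "c' = Seq c1 c2" "(c1, s') \<in> set_pmf (step c s)"
      using move.hyps by auto
    have "evaluates S (t + u + 1) (Seq c1 c2) s' (bind_pmf (H c1 s') G)"
      using c1 by (intro move.IH move.prems) (auto intro!: bexI[of _ "(c1, s')"])
    then show "evaluates S (t + u + 1) c' s' (case c' of Seq c1 c2 \<Rightarrow> bind_pmf (H c1 s') G)"
      using c1 by simp
  qed (use move.hyps in auto)
  then show ?case using move
    by (simp add: bind_assoc_pmf bind_map_pmf split_def)
qed

lemma evaluates_return:
  assumes "c \<noteq> Skip" "step c s = return_pmf (c', s')" "fits S s" "evaluates S t c' s' M"
  shows "evaluates S (Suc t) c s M"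
  using evaluates.move[of c S s t "\<lambda>_ _. M"] assms by (simp add: bind_return_pmf)

lemma fits_ISet: "fits S s \<Longrightarrow> a < S \<Longrightarrow> v < S \<Longrightarrow> fits S (s\<lparr>icell := (icell s)(a := v)\<rparr>)"
  by (auto simp: fits_def)

lemma fits_RSet: "fits S s \<Longrightarrow> a < S \<Longrightarrow> fits S (s\<lparr>rcell := (rcell s)(a := v)\<rparr>)"
  by (auto simp: fits_def)

text \<open>Forgets the distribution and keeps its support, which is enough for all code apart from
  the drawing of the sign matrix. \<open>fits\<close> is built in as a precondition, so that rules
  need not carry it.\<close>

definition ensures :: "nat \<Rightarrow> nat \<Rightarrow> com \<Rightarrow> store \<Rightarrow> (store \<Rightarrow> bool) \<Rightarrow> bool" where
  "ensures S t c s Q \<longleftrightarrow> (fits S s \<longrightarrow> (\<exists>M. evaluates S t c s M \<and> (\<forall>s' \<in> set_pmf M. Q s')))"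

lemma ensures_mono:
  assumes "ensures S t c s Q" "t \<le> t'" "\<And>s'. fits S s' \<Longrightarrow> Q s' \<Longrightarrow> Q' s'"
  shows "ensures S t' c s Q'"
  using assms evaluates_mono evaluates_fits_result unfolding ensures_def by meson

lemma ensures_Skip: "Q s \<Longrightarrow> ensures S t Skip s Q"
  unfolding ensures_def using evaluates.halt by fastforce

lemma ensures_ISet:
  assumes "1 \<le> t" "ival a s < S" "ival e s < S" "Q (s\<lparr>icell := (icell s)(ival a s := ival e s)\<rparr>)"
  shows "ensures S t (ISet a e) s Q"
  unfolding ensures_def
  using assms by (cases t) (auto intro!: exI evaluates_return evaluates.halt fits_ISet)

lemma ensures_RSet:
  assumes "1 \<le> t" "ival a s < S" "Q (s\<lparr>rcell := (rcell s)(ival a s := rval e s)\<rparr>)"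
  shows "ensures S t (RSet a e) s Q"
  unfolding ensures_def
  using assms by (cases t) (auto intro!: exI evaluates_return evaluates.halt fits_RSet)

lemma ensures_Seq:
  assumes "ensures S t c s R" "\<And>s'. fits S s' \<Longrightarrow> R s' \<Longrightarrow> ensures S u c2 s' Q"
  shows "ensures S (t + u + 1) (Seq c c2) s Q"
  unfolding ensures_def
proof
  assume "fits S s"
  then obtain M where M: "evaluates S t c s M" "\<forall>s' \<in> set_pmf M. R s'"
    using assms(1) by (auto simp: ensures_def)
  then have "\<forall>s' \<in> set_pmf M. \<exists>M'. evaluates S u c2 s' M' \<and> (\<forall>s' \<in> set_pmf M'. Q s')"
    using assms(2) evaluates_fits_result unfolding ensures_def by blast
  then obtain G where "\<forall>s' \<in> set_pmf M. evaluates S u c2 s' (G s') \<and> (\<forall>s' \<in> set_pmf (G s'). Q s')"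
    by metis
  then show "\<exists>M. evaluates S (t + u + 1) (Seq c c2) s M \<and> (\<forall>s' \<in> set_pmf M. Q s')"
    using evaluates_Seq[OF M(1)] by (intro exI[of _ "bind_pmf M G"]) auto
qed

lemma ensures_If:
  assumes "holds b s \<Longrightarrow> ensures S t c1 s Q" "\<not> holds b s \<Longrightarrow> ensures S t c2 s Q"
  shows "ensures S (t + 1) (If b c1 c2) s Q"
  unfolding ensures_def
proof
  assume f: "fits S s"
  have "ensures S t (if holds b s then c1 else c2) s Q"
    using assms by simp
  then obtain M where "evaluates S t (if holds b s then c1 else c2) s M" "\<forall>s' \<in> set_pmf M. Q s'"
    using f unfolding ensures_def by blast
  then show "\<exists>M. evaluates S (t + 1) (If b c1 c2) s M \<and> (\<forall>s' \<in> set_pmf M. Q s')"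
    using f by (auto intro!: exI evaluates_return)
qed

text \<open>The index of \<open>I\<close> counts the remaining iterations, so the time bound follows
  by induction on it. A round costs two steps besides the body: the test, and the removal of the
  finished body from the sequence. The final 1 is the failing test.\<close>

lemma ensures_While:
  assumes "I N s"
    and body: "\<And>k s. k < N \<Longrightarrow> I (Suc k) s \<Longrightarrow> fits S s \<Longrightarrow> holds b s \<and> ensures S t c s (I k)"
    and exit: "\<And>s. I 0 s \<Longrightarrow> \<not> holds b s \<and> Q s"
  shows "ensures S (N * (t + 2) + 1) (While b c) s Q"
proof -
  have "ensures S (k * (t + 2) + 1) (While b c) s Q" if "I k s" "k \<le> N" for k s
    using that
  proof (induction k arbitrary: s)
    case 0
    then have "\<not> holds b s" "Q s" using exit by auto
    then show ?case
      unfolding ensures_def by (auto intro!: exI evaluates_return evaluates.halt)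
  next
    case (Suc k)
    show ?case unfolding ensures_def
    proof
      assume f: "fits S s"
      have h: "holds b s" "ensures S t c s (I k)" using body[of k s] Suc.prems f by auto
      have "ensures S (t + (k * (t + 2) + 1) + 1) (Seq c (While b c)) s Q"
        using Suc by (intro ensures_Seq[OF h(2)]) auto
      then obtain M where "evaluates S (t + (k * (t + 2) + 1) + 1) (Seq c (While b c)) s M"
        "\<forall>s' \<in> set_pmf M. Q s'" using f by (auto simp: ensures_def)
      then have "evaluates S (Suc (t + (k * (t + 2) + 1) + 1)) (While b c) s M"
        using f h by (intro evaluates_return) auto
      then show "\<exists>M. evaluates S (Suc k * (t + 2) + 1) (While b c) s M \<and> (\<forall>s' \<in> set_pmf M. Q s')"
        using \<open>\<forall>s' \<in> set_pmf M. Q s'\<close> by (auto intro!: exI elim!: evaluates_mono)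
    qed
  qed
  then show ?thesis using assms(1) by simp
qed

definition For :: "nat \<Rightarrow> iexp \<Rightarrow> com \<Rightarrow> com" where
  "For x b c = Seq (ISet (IConst x) (IConst 0))
     (While (ILess (ICell (IConst x)) b)
        (Seq c (ISet (IConst x) (IAdd (ICell (IConst x)) (IConst 1)))))"

text \<open>Turns the countdown of \<open>ensures_While\<close> into the rising counter in cell
  \<open>x\<close>. The body has to establish the next invariant for the store in which the
  increment has already taken place; the increment and its \<open>Seq\<close> raise the overhead per
  round from 2 to 4.\<close>

lemma ensures_For:
  assumes "x < S" "N < S"
    and init: "I 0 (s\<lparr>icell := (icell s)(x := 0)\<rparr>)"
    and bound: "\<And>k s. I k s \<Longrightarrow> ival b s = N"
    and body: "\<And>k s. k < N \<Longrightarrow> I k s \<Longrightarrow> icell s x = k \<Longrightarrow> fits S s \<Longrightarrow>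
      ensures S t c s (\<lambda>s'. icell s' x = k \<and> I (Suc k) (s'\<lparr>icell := (icell s')(x := Suc k)\<rparr>))"
    and exit: "\<And>s. I N s \<Longrightarrow> icell s x = N \<Longrightarrow> Q s"
  shows "ensures S (N * (t + 4) + 3) (For x b c) s Q"
proof -
  let ?R = "\<lambda>s'. s' = s\<lparr>icell := (icell s)(x := 0)\<rparr>"
  let ?J = "\<lambda>k s. k \<le> N \<and> icell s x = N - k \<and> I (N - k) s"
  have "ensures S (1 + (N * ((t + 2) + 2) + 1) + 1) (For x b c) s Q"
    unfolding For_def
  proof (rule ensures_Seq[where R = ?R])
    show "ensures S 1 (ISet (IConst x) (IConst 0)) s ?R"
      using assms by (intro ensures_ISet) auto
    fix s' assume s': "?R s'"
    show "ensures S (N * (t + 2 + 2) + 1) (While (ILess (ICell (IConst x)) b)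
        (Seq c (ISet (IConst x) (IAdd (ICell (IConst x)) (IConst 1))))) s' Q"
    proof (rule ensures_While[where I = ?J])
      show "N \<le> N \<and> icell s' x = N - N \<and> I (N - N) s'" using s' init by simp
    next
      fix k s assume *: "k < N" "Suc k \<le> N \<and> icell s x = N - Suc k \<and> I (N - Suc k) s" "fits S s"
      have "ensures S (t + 1 + 1) (Seq c (ISet (IConst x) (IAdd (ICell (IConst x)) (IConst 1)))) s (?J k)"
      proof (rule ensures_Seq)
        show "ensures S t c s (\<lambda>s'. icell s' x = N - Suc k \<and>
            I (Suc (N - Suc k)) (s'\<lparr>icell := (icell s')(x := Suc (N - Suc k))\<rparr>))"
          using * by (intro body) auto
        fix s' assume s': "fits S s'" "icell s' x = N - Suc k \<and>
            I (Suc (N - Suc k)) (s'\<lparr>icell := (icell s')(x := Suc (N - Suc k))\<rparr>)"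
        show "ensures S 1 (ISet (IConst x) (IAdd (ICell (IConst x)) (IConst 1))) s' (?J k)"
          using * s' assms(1,2) by (intro ensures_ISet) (auto simp: Suc_diff_Suc)
      qed
      then show "holds (ILess (ICell (IConst x)) b) s \<and>
          ensures S (t + 2) (Seq c (ISet (IConst x) (IAdd (ICell (IConst x)) (IConst 1)))) s (?J k)"
        using * bound by auto
    qed (use bound exit in auto)
  qed
  then show ?thesis by (rule ensures_mono) (auto simp: algebra_simps)
qed

definition Accumulate :: "nat \<Rightarrow> iexp \<Rightarrow> rexp \<Rightarrow> com" where
  "Accumulate x b e =
     Seq (RSet (IConst 4) (RNat (IConst 0))) (For x b (RSet (IConst 4) (RAdd (RCell (IConst 4)) e)))"

text \<open>The result is an exact store instead of a relation, so callers can treat a summation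
  like a single assignment. The summand must be insensitive to the accumulator in real cell
  4.\<close>

lemma ensures_Accumulate:
  assumes "x < S" "N < S" "4 < S"
    and bound: "\<And>k v. ival b (s\<lparr>icell := (icell s)(x := k), rcell := (rcell s)(4 := v)\<rparr>) = N"
    and summand: "\<And>k v. k < N \<Longrightarrow> rval e (s\<lparr>icell := (icell s)(x := k), rcell := (rcell s)(4 := v)\<rparr>) = f k"
    and Q: "Q (s\<lparr>icell := (icell s)(x := N), rcell := (rcell s)(4 := \<Sum>k<N. f k)\<rparr>)"
  shows "ensures S (N * 5 + 5) (Accumulate x b e) s Q"
proof -
  let ?I = "\<lambda>k s'. s' = s\<lparr>icell := (icell s)(x := k), rcell := (rcell s)(4 := \<Sum>k<k. f k)\<rparr>"
  have "ensures S (1 + (N * (1 + 4) + 3) + 1) (Accumulate x b e) s Q"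
    unfolding Accumulate_def
  proof (rule ensures_Seq)
    show "ensures S 1 (RSet (IConst 4) (RNat (IConst 0))) s (\<lambda>s'. s' = s\<lparr>rcell := (rcell s)(4 := 0)\<rparr>)"
      using assms by (intro ensures_RSet) auto
    show "ensures S (N * (1 + 4) + 3) (For x b (RSet (IConst 4) (RAdd (RCell (IConst 4)) e))) s' Q"
      if "s' = s\<lparr>rcell := (rcell s)(4 := 0)\<rparr>" for s'
      by (rule ensures_For[where I = ?I])
         (use that assms(1-3) Q in \<open>auto intro!: ensures_RSet simp: summand bound fun_upd_twist\<close>)
  qed
  then show ?thesis by (simp add: algebra_simps)
qed

section \<open>Random sign sketches\<close>

abbreviation coins :: "nat \<Rightarrow> bool list pmf" where
  "coins N \<equiv> replicate_pmf N (bernoulli_pmf (1/2))"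

definition signed :: "bool \<Rightarrow> real" where
  "signed b = (if b then 1 else -1)"

lemma length_coins: "bs \<in> set_pmf (coins N) \<Longrightarrow> length bs = N"
  by (simp add: set_replicate_pmf)

lemma finite_coins: "finite (set_pmf (coins N))"
  by (induction N) auto

lemma integrable_coins: "integrable (measure_pmf (coins N)) (f :: bool list \<Rightarrow> real)"
  by (intro integrable_measure_pmf_finite finite_coins)

lemma expectation_coins_Suc:
  "measure_pmf.expectation (coins (Suc N)) (f :: bool list \<Rightarrow> real) =
     (measure_pmf.expectation (coins N) (\<lambda>bs. f (True # bs)) +
      measure_pmf.expectation (coins N) (\<lambda>bs. f (False # bs))) / 2"
proof -
  have "coins (Suc N) = bind_pmf (bernoulli_pmf (1/2)) (\<lambda>b. map_pmf (Cons b) (coins N))"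
    by (simp add: map_pmf_def)
  then show ?thesis
    by (simp add: pmf_expectation_bind[where A = UNIV] finite_coins UNIV_bool)
qed

lemma expectation_coins_add:
  "measure_pmf.expectation (coins (M + N)) (f :: bool list \<Rightarrow> real) =
     measure_pmf.expectation (coins M) (\<lambda>xs. measure_pmf.expectation (coins N) (\<lambda>ys. f (xs @ ys)))"
proof (induction M arbitrary: f)
  case (Suc M)
  show ?case
    unfolding add_Suc expectation_coins_Suc Suc by simp
qed simp

section \<open>Exponential moments and tails of sign sketches\<close>

lemma cosh_le_exp: "(exp x + exp (- x)) / 2 \<le> exp (x\<^sup>2 / 2)" for x :: real
proof -
  have *: "(exp h + exp (- h)) / 2 \<le> exp (h\<^sup>2 / 2)" if "h \<ge> 0" for h :: real
  proof -
    \<comment> \<open>This is the analytic core of Hoeffding's lemma, taken for a fair variable on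
      an interval of length \<open>2 * h\<close>; symmetry of the claim covers negative
      \<open>x\<close> below.\<close>
    have "- (2 * h) * (1/2) + ln (1 + 1/2 * (exp (2 * h) - 1)) \<le> (2 * h)\<^sup>2 / 8"
      using that by (intro Hoeffdings_lemma_aux) auto
    then have "ln ((1 + exp (2 * h)) / 2) - h \<le> h\<^sup>2 / 2"
      by (simp add: field_simps power2_eq_square)
    moreover have "(exp h + exp (- h)) / 2 = exp (ln ((1 + exp (2 * h)) / 2) - h)"
      by (simp add: exp_diff add_pos_pos exp_minus field_simps flip: exp_add)
    ultimately show ?thesis by simp
  qed
  show ?thesis using *[of x] *[of "- x"] by (cases "x \<ge> 0") (auto simp: add.commute)
qed

text \<open>
  The exponent \<open>l + 4 l\<^sup>2 s\<close>, where \<open>s\<close> is the sum of the squares of \<open>u\<close>, is chosen so that the coordinates can be averaged out one at a time,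
  for both signs of \<open>l\<close>, with no growth of the constants.
\<close>

lemma mgf_signed_sum_square:
  fixes u :: "nat \<Rightarrow> real"
  assumes "\<bar>l\<bar> * (\<Sum>k<d. (u k)\<^sup>2) \<le> 1/10"
  shows "measure_pmf.expectation (coins d) (\<lambda>bs. exp (l * (a + (\<Sum>k<d. signed (bs ! k) * u k))\<^sup>2))
    \<le> exp ((l + 4 * l\<^sup>2 * (\<Sum>k<d. (u k)\<^sup>2)) * ((\<Sum>k<d. (u k)\<^sup>2) + a\<^sup>2))"
  using assms
proof (induction d arbitrary: a u)
  case 0
  show ?case by simp
next
  case (Suc d)
  define s where "s = (\<Sum>k<d. (u (Suc k))\<^sup>2)"
  define z where "z = (u 0)\<^sup>2"
  define \<kappa> where "\<kappa> = l + 4 * l\<^sup>2 * s"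
  have split: "(\<Sum>k<Suc d. f k) = f 0 + (\<Sum>k<d. f (Suc k))" for f :: "nat \<Rightarrow> real"
    by (rule sum.lessThan_Suc_shift)
  have sz: "s \<ge> 0" "z \<ge> 0" by (auto simp: s_def z_def sum_nonneg)
  have ls: "\<bar>l\<bar> * (s + z) \<le> 1/10"
    using Suc.prems unfolding split by (simp add: s_def z_def add.commute)
  have l1: "\<bar>l\<bar> * s \<le> 1/10" using ls sz by (simp add: algebra_simps)
      (smt (verit) abs_ge_zero mult_nonneg_nonneg)
  have IH: "measure_pmf.expectation (coins d)
      (\<lambda>bs. exp (l * (b + (\<Sum>k<d. signed (bs ! k) * u (Suc k)))\<^sup>2)) \<le> exp (\<kappa> * (s + b\<^sup>2))" for b
    using Suc.IH[of "\<lambda>k. u (Suc k)" b] l1 unfolding s_def \<kappa>_def by blast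
  \<comment> \<open>The smallness assumption gives
    \<open>\<bar>\<kappa>\<bar> \<le> 1.4 * \<bar>l\<bar>\<close>, and twice 1.96 stays below 4: so
    the 1/10 and the 4 fit together, and the same 4 survives the induction.\<close>
  have \<kappa>2: "2 * \<kappa>\<^sup>2 \<le> 4 * l\<^sup>2"
  proof -
    have "\<bar>\<kappa>\<bar> \<le> \<bar>l\<bar> * (1 + 4 * (\<bar>l\<bar> * s))"
      using sz abs_triangle_ineq[of l "4 * l\<^sup>2 * s"]
      by (simp add: \<kappa>_def algebra_simps power2_eq_square abs_mult)
    also have "\<dots> \<le> \<bar>l\<bar> * (14/10)" using l1 by (intro mult_left_mono) linarith+
    finally have "\<bar>\<kappa>\<bar>\<^sup>2 \<le> (\<bar>l\<bar> * (14/10))\<^sup>2" by (rule power_mono) simp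
    then have "\<kappa>\<^sup>2 * 25 \<le> 49 * l\<^sup>2" by (simp add: power_mult_distrib power2_eq_square)
    then show ?thesis using zero_le_power2[of l] by linarith
  qed
  have "measure_pmf.expectation (coins (Suc d))
      (\<lambda>bs. exp (l * (a + (\<Sum>k<Suc d. signed (bs ! k) * u k))\<^sup>2)) =
    (measure_pmf.expectation (coins d)
       (\<lambda>bs. exp (l * ((a + u 0) + (\<Sum>k<d. signed (bs ! k) * u (Suc k)))\<^sup>2)) +
     measure_pmf.expectation (coins d)
       (\<lambda>bs. exp (l * ((a - u 0) + (\<Sum>k<d. signed (bs ! k) * u (Suc k)))\<^sup>2))) / 2"
    unfolding expectation_coins_Suc split by (simp add: signed_def algebra_simps)
  also have "\<dots> \<le> (exp (\<kappa> * (s + (a + u 0)\<^sup>2)) + exp (\<kappa> * (s + (a - u 0)\<^sup>2))) / 2"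
    using IH[of "a + u 0"] IH[of "a - u 0"] by simp
  \<comment> \<open>The sign of coordinate 0 enters only through the cross term of the square;
    averaging over it leaves a cosh, which costs \<open>2 * \<kappa>\<^sup>2 * z * a\<^sup>2\<close>
    in the exponent.\<close>
  also have "\<dots> = exp (\<kappa> * (s + z + a\<^sup>2)) * ((exp (2 * \<kappa> * a * u 0) + exp (- (2 * \<kappa> * a * u 0))) / 2)"
    by (simp add: z_def algebra_simps power2_eq_square flip: exp_add)
  also have "\<dots> \<le> exp (\<kappa> * (s + z + a\<^sup>2)) * exp ((2 * \<kappa> * a * u 0)\<^sup>2 / 2)"
    by (intro mult_left_mono cosh_le_exp) auto
  also have "\<dots> = exp (\<kappa> * (s + z) + (\<kappa> + 2 * \<kappa>\<^sup>2 * z) * a\<^sup>2)"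
    by (simp add: z_def algebra_simps power2_eq_square flip: exp_add)
  also have "\<dots> \<le> exp ((l + 4 * l\<^sup>2 * (s + z)) * ((s + z) + a\<^sup>2))"
  proof -
    have 1: "\<kappa> \<le> l + 4 * l\<^sup>2 * (s + z)" using sz by (simp add: \<kappa>_def algebra_simps)
    have "2 * \<kappa>\<^sup>2 * z \<le> 4 * l\<^sup>2 * z" using \<kappa>2 sz by (intro mult_right_mono) auto
    then have 2: "\<kappa> + 2 * \<kappa>\<^sup>2 * z \<le> l + 4 * l\<^sup>2 * (s + z)" by (simp add: \<kappa>_def algebra_simps)
    have "\<kappa> * (s + z) \<le> (l + 4 * l\<^sup>2 * (s + z)) * (s + z)"
      using 1 sz by (intro mult_right_mono) auto
    moreover have "(\<kappa> + 2 * \<kappa>\<^sup>2 * z) * a\<^sup>2 \<le> (l + 4 * l\<^sup>2 * (s + z)) * a\<^sup>2"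
      using 2 by (intro mult_right_mono) auto
    ultimately show ?thesis by (simp add: distrib_left)
  qed
  finally show ?case unfolding split by (simp add: s_def z_def add.commute)
qed

text \<open>The sign matrix is one bit sequence, stored row by row as in memory. There is no scaling
  by the number of rows; \<open>estimate\<close> divides by it.\<close>

definition sketch :: "nat \<Rightarrow> (nat \<Rightarrow> bool) \<Rightarrow> (nat \<Rightarrow> real) \<Rightarrow> nat \<Rightarrow> real" where
  "sketch d \<sigma> u j = (\<Sum>k<d. signed (\<sigma> (j * d + k)) * u k)"

lemma sketch_diff: "sketch d \<sigma> u j - sketch d \<sigma> v j = sketch d \<sigma> (\<lambda>k. u k - v k) j"
  by (simp add: sketch_def algebra_simps sum_subtractf)

text \<open>Row \<open>j\<close> uses the block of \<open>d\<close> coins from \<open>j * d\<close>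
  on, so the rows are independent: splitting off the first \<open>d\<close> coins peels off row 0
  and shifts the other rows down by one.\<close>

lemma mgf_sketch:
  "measure_pmf.expectation (coins (m * d)) (\<lambda>bs. exp (l * (\<Sum>j<m. (sketch d ((!) bs) u j)\<^sup>2))) =
     (measure_pmf.expectation (coins d) (\<lambda>bs. exp (l * (\<Sum>k<d. signed (bs ! k) * u k)\<^sup>2))) ^ m"
proof (induction m)
  case (Suc m)
  have *: "sketch d ((!) (xs @ ys)) u 0 = (\<Sum>k<d. signed (xs ! k) * u k)"
    "sketch d ((!) (xs @ ys)) u (Suc j) = sketch d ((!) ys) u j"
    if "xs \<in> set_pmf (coins d)" for xs ys j
    using length_coins[OF that] by (auto simp: sketch_def nth_append intro!: sum.cong)
  have "measure_pmf.expectation (coins (Suc m * d))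
      (\<lambda>bs. exp (l * (\<Sum>j<Suc m. (sketch d ((!) bs) u j)\<^sup>2))) =
    measure_pmf.expectation (coins d) (\<lambda>xs. measure_pmf.expectation (coins (m * d)) (\<lambda>ys.
      exp (l * (\<Sum>j<Suc m. (sketch d ((!) (xs @ ys)) u j)\<^sup>2))))"
    by (simp add: expectation_coins_add del: sum.lessThan_Suc)
  also have "\<dots> = measure_pmf.expectation (coins d) (\<lambda>xs. measure_pmf.expectation (coins (m * d)) (\<lambda>ys.
      exp (l * (\<Sum>k<d. signed (xs ! k) * u k)\<^sup>2) * exp (l * (\<Sum>j<m. (sketch d ((!) ys) u j)\<^sup>2))))"
    by (intro integral_cong_AE AE_pmfI)
       (auto simp: * sum.lessThan_Suc_shift distrib_left exp_add simp del: sum.lessThan_Suc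
             intro!: integral_cong_AE AE_pmfI)
  finally show ?case using Suc by simp
qed simp

text \<open>Chernoff's method for both tails at once: \<open>\<theta> = 1\<close> is the upper tail,
  and \<open>\<theta> = -1\<close> says after negation that the sum falls below
  \<open>(1 - \<epsilon>) * real m * s\<close>.\<close>

lemma sketch_tail:
  fixes u :: "nat \<Rightarrow> real" and d :: nat
  assumes \<theta>: "\<theta> = 1 \<or> \<theta> = -1" and \<epsilon>: "0 < \<epsilon>" "\<epsilon> < 1"
  defines "s \<equiv> \<Sum>k<d. (u k)\<^sup>2"
  shows "measure_pmf.prob (coins (m * d))
     {bs. \<theta> * (\<Sum>j<m. (sketch d ((!) bs) u j)\<^sup>2) > (\<theta> + \<epsilon>) * real m * s} \<le> 1 / (1 + \<epsilon>\<^sup>2 / 20) ^ m"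
    (is "measure_pmf.prob _ ?A \<le> _")
proof (cases "s = 0")
  case True
  then have "u k = 0" if "k < d" for k using that by (simp add: s_def sum_nonneg_eq_0_iff)
  then have "sketch d \<sigma> u j = 0" for \<sigma> j by (simp add: sketch_def)
  then have "?A = {}" using True by simp
  then show ?thesis by simp
next
  case False
  then have s: "s > 0" by (simp add: s_def less_le sum_nonneg)
  \<comment> \<open>With \<open>l * s = \<epsilon> / 10\<close> the smallness assumption of the
    moment bound holds, and the exponent per row is
    \<open>4 * (l * s)\<^sup>2 - \<epsilon> * (l * s)\<close>, that is
    \<open>- 6 * \<epsilon>\<^sup>2 / 100\<close>, which is at most
    \<open>- (\<epsilon>\<^sup>2 / 20)\<close>.\<close>
  define l where "l = \<epsilon> / (10 * s)"
  have l: "l > 0" using s \<epsilon> by (simp add: l_def)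
  have ls: "l * s = \<epsilon> / 10" using s by (simp add: l_def)
  let ?Z = "\<lambda>bs. \<Sum>j<m. (sketch d ((!) bs) u j)\<^sup>2"
  have \<theta>2: "\<theta>\<^sup>2 = 1" "\<theta> * \<theta> = 1" "\<bar>\<theta>\<bar> = 1" using \<theta> by auto
  have "measure_pmf.prob (coins (m * d)) ?A = measure_pmf.expectation (coins (m * d)) (indicator ?A)"
    by simp
  also have "\<dots> \<le> measure_pmf.expectation (coins (m * d))
      (\<lambda>bs. exp (l * \<theta> * ?Z bs) * exp (- (l * (\<theta> + \<epsilon>) * m * s)))"
  proof (intro integral_mono integrable_coins)
    fix bs
    have "1 \<le> exp (l * (\<theta> * ?Z bs - (\<theta> + \<epsilon>) * real m * s))" if "bs \<in> ?A"
      using that l by simp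
    then show "indicator ?A bs \<le> exp (l * \<theta> * ?Z bs) * exp (- (l * (\<theta> + \<epsilon>) * m * s))"
      by (auto simp: indicator_def algebra_simps simp flip: exp_add)
  qed
  also have "\<dots> = (measure_pmf.expectation (coins d)
      (\<lambda>bs. exp (l * \<theta> * (\<Sum>k<d. signed (bs ! k) * u k)\<^sup>2)) * exp (- (l * (\<theta> + \<epsilon>) * s))) ^ m"
    by (simp add: mgf_sketch power_mult_distrib) (simp add: mult_ac flip: exp_of_nat_mult)
  also have "\<dots> \<le> (exp (- (\<epsilon>\<^sup>2 / 20))) ^ m"
  proof (intro power_mono mult_nonneg_nonneg)
    have "measure_pmf.expectation (coins d)
        (\<lambda>bs. exp (l * \<theta> * (0 + (\<Sum>k<d. signed (bs ! k) * u k))\<^sup>2))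
      \<le> exp ((l * \<theta> + 4 * (l * \<theta>)\<^sup>2 * s) * (s + 0\<^sup>2))"
      unfolding s_def
    proof (intro mgf_signed_sum_square)
      show "\<bar>l * \<theta>\<bar> * (\<Sum>k<d. (u k)\<^sup>2) \<le> 1 / 10"
        using ls l \<epsilon> \<theta>2 unfolding s_def[symmetric] by (simp add: abs_mult)
    qed
    then have "measure_pmf.expectation (coins d) (\<lambda>bs. exp (l * \<theta> * (\<Sum>k<d. signed (bs ! k) * u k)\<^sup>2))
        * exp (- (l * (\<theta> + \<epsilon>) * s)) \<le> exp ((l * \<theta> + 4 * (l * \<theta>)\<^sup>2 * s) * s) * exp (- (l * (\<theta> + \<epsilon>) * s))"
      by simp
    also have "\<dots> = exp (4 * (l * s)\<^sup>2 - \<epsilon> * (l * s))"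
      by (simp add: power_mult_distrib \<theta>2 algebra_simps power2_eq_square flip: exp_add)
    also have "\<dots> \<le> exp (- (\<epsilon>\<^sup>2 / 20))"
      unfolding ls by (simp add: power2_eq_square)
    finally show "measure_pmf.expectation (coins d)
        (\<lambda>bs. exp (l * \<theta> * (\<Sum>k<d. signed (bs ! k) * u k)\<^sup>2)) * exp (- (l * (\<theta> + \<epsilon>) * s))
        \<le> exp (- (\<epsilon>\<^sup>2 / 20))" .
  qed (auto intro!: integral_nonneg_AE AE_pmfI)
  \<comment> \<open>A weaker rate, but one that the program can evaluate by arithmetic
    alone.\<close>
  also have "\<dots> \<le> (1 / (1 + \<epsilon>\<^sup>2 / 20)) ^ m"
  proof (rule power_mono)
    have "1 + \<epsilon>\<^sup>2 / 20 \<le> exp (\<epsilon>\<^sup>2 / 20)" by (rule exp_ge_add_one_self)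
    moreover have "0 < 1 + \<epsilon>\<^sup>2 / 20" by (simp add: add_pos_nonneg)
    ultimately show "exp (- (\<epsilon>\<^sup>2 / 20)) \<le> 1 / (1 + \<epsilon>\<^sup>2 / 20)"
      by (simp add: exp_minus field_simps)
  qed simp
  finally show ?thesis by (simp add: power_one_over)
qed

text \<open>A union bound: \<open>n * q\<close> vectors with two tails each account for the factor
  in front.\<close>

lemma sketch_failure:
  fixes u :: "nat \<Rightarrow> nat \<Rightarrow> nat \<Rightarrow> real" and d m :: nat
  assumes \<epsilon>: "0 < \<epsilon>" "\<epsilon> < 1"
  defines "s \<equiv> \<lambda>i t. \<Sum>k<d. (u i t k)\<^sup>2"
  defines "Z \<equiv> \<lambda>bs i t. \<Sum>j<m. (sketch d ((!) bs) (u i t) j)\<^sup>2"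
  shows "measure_pmf.prob (coins (m * d)) {bs. \<not> (\<forall>i<n. \<forall>t<q.
      (1 - \<epsilon>) * real m * s i t \<le> Z bs i t \<and> Z bs i t \<le> (1 + \<epsilon>) * real m * s i t)}
    \<le> 2 * real n * real q / (1 + \<epsilon>\<^sup>2 / 20) ^ m"
proof -
  let ?A = "\<lambda>(i, t, \<theta>). {bs. \<theta> * Z bs i t > (\<theta> + \<epsilon>) * real m * s i t}"
  let ?I = "{..<n} \<times> {..<q} \<times> {1, -1 :: real}"
  have "measure_pmf.prob (coins (m * d)) {bs. \<not> (\<forall>i<n. \<forall>t<q.
      (1 - \<epsilon>) * real m * s i t \<le> Z bs i t \<and> Z bs i t \<le> (1 + \<epsilon>) * real m * s i t)}
    \<le> measure_pmf.prob (coins (m * d)) (\<Union>(?A ` ?I))"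
  proof (rule measure_pmf.finite_measure_mono, rule subsetI)
    fix bs assume "bs \<in> {bs. \<not> (\<forall>i<n. \<forall>t<q.
      (1 - \<epsilon>) * real m * s i t \<le> Z bs i t \<and> Z bs i t \<le> (1 + \<epsilon>) * real m * s i t)}"
    then obtain i t where it: "i < n" "t < q"
      "Z bs i t < (1 - \<epsilon>) * real m * s i t \<or> (1 + \<epsilon>) * real m * s i t < Z bs i t"
      by (auto simp: not_le)
    then have "bs \<in> ?A (i, t, -1) \<or> bs \<in> ?A (i, t, 1)"
      by (auto simp: algebra_simps)
    then show "bs \<in> \<Union>(?A ` ?I)" using it(1,2) by blast
  qed simp
  also have "\<dots> \<le> (\<Sum>p\<in>?I. measure_pmf.prob (coins (m * d)) (?A p))"
    by (intro measure_pmf.finite_measure_subadditive_finite) auto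
  also have "\<dots> \<le> (\<Sum>p\<in>?I. 1 / (1 + \<epsilon>\<^sup>2 / 20) ^ m)"
    using sketch_tail[OF _ \<epsilon>] unfolding s_def Z_def by (intro sum_mono) auto
  also have "\<dots> = 2 * real n * real q / (1 + \<epsilon>\<^sup>2 / 20) ^ m"
    by (simp add: card_cartesian_product)
  finally show ?thesis .
qed

section \<open>Greedy matching with approximate weights\<close>

definition share :: "real list list \<Rightarrow> real list list \<Rightarrow> nat list \<Rightarrow> nat \<Rightarrow> real" where
  "share xs ys is i =
     (if partners is i = {} then 0 else Max ((\<lambda>t. weight (xs ! i) (ys ! t)) ` partners is i))"

lemma matching_value_share: "matching_value xs ys is = (\<Sum>i<length xs. share xs ys is i)"
  by (simp add: matching_value_def share_def)

lemma weight_nonneg: "0 \<le> weight x y"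
  by (simp add: weight_def)

lemma finite_partners: "finite (partners is i)"
  by (simp add: partners_def)

lemma share_nonneg: "0 \<le> share xs ys is i"
  by (auto simp: share_def Max_ge_iff finite_partners weight_nonneg ex_in_conv)

lemma share_Nil: "share xs ys [] i = 0"
  by (simp add: share_def partners_def)

lemma partners_snoc:
  "partners (is @ [b]) i = (if i = b then insert (length is) (partners is i) else partners is i)"
  by (auto simp: partners_def nth_append less_Suc_eq)

lemma share_snoc:
  assumes "length is = length ys"
  shows "share xs (ys @ [y]) (is @ [b]) =
    (share xs ys is)(b := max (share xs ys is b) (weight (xs ! b) y))"
proof
  fix i
  let ?w = "\<lambda>t. weight (xs ! i) (ys ! t)"
  have *: "(\<lambda>t. weight (xs ! i) ((ys @ [y]) ! t)) ` partners is i = ?w ` partners is i"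
    using assms by (intro image_cong) (auto simp: partners_def nth_append)
  show "share xs (ys @ [y]) (is @ [b]) i =
      ((share xs ys is)(b := max (share xs ys is b) (weight (xs ! b) y))) i"
  proof (cases "partners is i = {}")
    case True
    then show ?thesis using assms by (auto simp: share_def partners_snoc weight_nonneg max_def)
  next
    case False
    then show ?thesis using assms * finite_partners[of "is" i]
      by (cases "i = b") (simp_all add: share_def partners_snoc max.commute)
  qed
qed

lemma matching_value_snoc:
  assumes "length is = length ys" "b < length xs"
  shows "matching_value xs (ys @ [y]) (is @ [b]) =
    matching_value xs ys is + (max (share xs ys is b) (weight (xs ! b) y) - share xs ys is b)"
  using assms by (simp add: matching_value_share share_snoc sum.remove[of _ b])

definition competitive :: "real \<Rightarrow> real list list \<Rightarrow> real list list \<Rightarrow> nat list \<Rightarrow> bool" where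
  "competitive c xs ys is \<longleftrightarrow> (\<forall>os \<in> assignments (length xs) (length ys).
     (\<Sum>i<length xs. max 0 (c * share xs ys os i - share xs ys is i)) \<le> matching_value xs ys is)"

lemma competitive_Nil: "competitive c xs [] []"
  by (simp add: competitive_def assignments_def share_Nil matching_value_share)

lemma competitive_snoc:
  assumes comp: "competitive c xs ys is" and len: "length is = length ys" and b: "b < length xs"
    and c: "0 \<le> c"
    and greedy: "\<And>i. i < length xs \<Longrightarrow> c * weight (xs ! i) y \<le>
      share xs ys is i + (max (share xs ys is b) (weight (xs ! b) y) - share xs ys is b)"
  shows "competitive c xs (ys @ [y]) (is @ [b])"
  unfolding competitive_def
proof
  let ?n = "length xs" and ?v = "share xs ys is" and ?v' = "share xs (ys @ [y]) (is @ [b])"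
  define g where "g = max (?v b) (weight (xs ! b) y) - ?v b"
  have g: "g \<ge> 0" by (simp add: g_def)
  have v': "?v i \<le> ?v' i" for i using len by (simp add: share_snoc)
  fix os assume "os \<in> assignments ?n (length (ys @ [y]))"
  then obtain os' a where os: "os = os' @ [a]" "os' \<in> assignments ?n (length ys)" "a < ?n"
    by (cases os rule: rev_cases) (auto simp: assignments_def)
  let ?o = "share xs ys os'"
  have len': "length os' = length ys" using os(2) by (simp add: assignments_def)
  \<comment> \<open>The new online point changes the competitor's share of \<open>a\<close> only,
    and all other excesses can only shrink. At \<open>a\<close> the excess caused by the new weight
    is at most \<open>g\<close>, which is what the greedy hypothesis provides.\<close>
  have "(\<Sum>i<?n. max 0 (c * share xs (ys @ [y]) os i - ?v' i))
      \<le> (\<Sum>i<?n. max 0 (c * ?o i - ?v i) + (if i = a then g else 0))"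
  proof (rule sum_mono)
    fix i assume i: "i \<in> {..<?n}"
    have "c * max (?o i) (weight (xs ! i) y) = max (c * ?o i) (c * weight (xs ! i) y)"
      using c by (simp add: max_mult_distrib_left)
    moreover have "c * weight (xs ! i) y \<le> ?v i + g" using greedy[of i] i by (simp add: g_def)
    ultimately show "max 0 (c * share xs (ys @ [y]) os i - ?v' i)
        \<le> max 0 (c * ?o i - ?v i) + (if i = a then g else 0)"
      using v'[of i] g len' by (auto simp: os(1) share_snoc)
  qed
  also have "\<dots> = (\<Sum>i<?n. max 0 (c * ?o i - ?v i)) + g"
    using os(3) by (simp add: sum.distrib)
  also have "\<dots> \<le> matching_value xs ys is + g"
    using comp os(2) by (simp add: competitive_def)
  also have "\<dots> = matching_value xs (ys @ [y]) (is @ [b])"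
    using len b by (simp add: matching_value_snoc g_def)
  finally show "(\<Sum>i<?n. max 0 (c * share xs (ys @ [y]) os i - ?v' i))
      \<le> matching_value xs (ys @ [y]) (is @ [b])" .
qed

lemma finite_assignments: "finite (assignments n m)"
  unfolding assignments_def by (rule finite_subset[OF _ finite_lists_length_eq[of "{..<n}" m]]) auto

lemma assignments_nonempty: "0 < n \<Longrightarrow> assignments n m \<noteq> {}"
  by (auto simp: assignments_def intro!: exI[of _ "replicate m 0"])

lemma opt_nonneg: "xs \<noteq> [] \<Longrightarrow> 0 \<le> opt xs ys"
  unfolding opt_def using assignments_nonempty[of "length xs" "length ys"]
  by (auto simp: Max_ge_iff finite_assignments matching_value_share intro!: sum_nonneg share_nonneg)

lemma competitive_ratio:
  assumes "competitive c xs ys is" "xs \<noteq> []" "0 \<le> c"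
  shows "c * opt xs ys \<le> 2 * matching_value xs ys is"
proof -
  have "opt xs ys \<in> matching_value xs ys ` assignments (length xs) (length ys)"
    unfolding opt_def using assms(2) by (intro Max_in) (auto simp: finite_assignments assignments_nonempty)
  then obtain os where os: "os \<in> assignments (length xs) (length ys)" "opt xs ys = matching_value xs ys os"
    by blast
  have "c * opt xs ys = (\<Sum>i<length xs. c * share xs ys os i)"
    by (simp add: os matching_value_share sum_distrib_left)
  also have "\<dots> \<le> (\<Sum>i<length xs. max 0 (c * share xs ys os i - share xs ys is i) + share xs ys is i)"
    by (intro sum_mono) auto
  also have "\<dots> \<le> 2 * matching_value xs ys is"
    using assms(1) os(1) by (simp add: competitive_def sum.distrib matching_value_share)
  finally show ?thesis .
qed

text \<open>One-sided error is what makes this work: as \<open>est b\<close> never exceeds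
  \<open>w b\<close>, the true gain at \<open>b\<close> is at least \<open>r\<close>, which
  dominates every estimated gain. The \<open>max 0\<close> admits the default choice made when no
  estimated gain is positive.\<close>

lemma greedy_choice:
  fixes v w est :: "nat \<Rightarrow> real"
  assumes "\<And>i. i < n \<Longrightarrow> c * w i \<le> est i" "\<And>i. i < n \<Longrightarrow> est i \<le> w i" "b < n"
    and "r \<le> max 0 (est b - v b)" "\<And>i. i < n \<Longrightarrow> est i - v i \<le> r" "i < n"
  shows "c * w i \<le> v i + (max (v b) (w b) - v b)"
  using assms(1)[of i] assms(2)[of b] assms(5)[of i] assms(3,4,6) by linarith

section \<open>Distance estimates from sketches\<close>

definition estimate :: "nat \<Rightarrow> nat \<Rightarrow> real \<Rightarrow> (nat \<Rightarrow> bool) \<Rightarrow> real list \<Rightarrow> real list \<Rightarrow> real" where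
  "estimate d m \<epsilon> \<sigma> x y =
     sqrt ((\<Sum>j<m. (sketch d \<sigma> ((!) x) j - sketch d \<sigma> ((!) y) j)\<^sup>2) / (real m * (1 + \<epsilon>)))"

definition accurate :: "nat \<Rightarrow> nat \<Rightarrow> real \<Rightarrow> (nat \<Rightarrow> bool) \<Rightarrow> real list \<Rightarrow> real list \<Rightarrow> bool" where
  "accurate d m \<epsilon> \<sigma> x y \<longleftrightarrow>
     max 0 (1 - 2 * \<epsilon>) * weight x y \<le> estimate d m \<epsilon> \<sigma> x y \<and> estimate d m \<epsilon> \<sigma> x y \<le> weight x y"

text \<open>Normalizing by \<open>1 + \<epsilon>\<close> turns the two-sided bound on the squared
  length into an underestimate. The relative loss is at most \<open>\<epsilon>\<close>, because the
  square of \<open>1 - \<epsilon>\<close> is at most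
  \<open>(1 - \<epsilon>) / (1 + \<epsilon>)\<close>; the weaker factor in \<open>accurate\<close>
  is that of the final ratio, cut off at 0.\<close>

lemma accurateI:
  assumes \<epsilon>: "0 < \<epsilon>" "\<epsilon> < 1" and m: "0 < m" and d: "length x = d"
    and lo: "(1 - \<epsilon>) * real m * (\<Sum>k<d. (x ! k - y ! k)\<^sup>2) \<le> (\<Sum>j<m. (sketch d \<sigma> (\<lambda>k. x ! k - y ! k) j)\<^sup>2)"
    and hi: "(\<Sum>j<m. (sketch d \<sigma> (\<lambda>k. x ! k - y ! k) j)\<^sup>2) \<le> (1 + \<epsilon>) * real m * (\<Sum>k<d. (x ! k - y ! k)\<^sup>2)"
  shows "accurate d m \<epsilon> \<sigma> x y"
proof -
  let ?w = "weight x y"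
  define Z where "Z = (\<Sum>j<m. (sketch d \<sigma> (\<lambda>k. x ! k - y ! k) j)\<^sup>2)"
  have w2: "?w\<^sup>2 = (\<Sum>k<d. (x ! k - y ! k)\<^sup>2)"
    by (simp add: weight_def L2_set_def d sum_nonneg)
  have est: "estimate d m \<epsilon> \<sigma> x y = sqrt (Z / (real m * (1 + \<epsilon>)))"
    by (simp add: estimate_def Z_def sketch_diff)
  have pos: "real m * (1 + \<epsilon>) > 0" using m \<epsilon> by simp
  have "Z / (real m * (1 + \<epsilon>)) \<le> ?w\<^sup>2"
    using hi pos unfolding w2 Z_def by (simp add: divide_le_eq mult_ac)
  then have "estimate d m \<epsilon> \<sigma> x y \<le> ?w"
    unfolding est using weight_nonneg real_le_lsqrt by simp
  moreover have "((1 - \<epsilon>) * ?w)\<^sup>2 \<le> Z / (real m * (1 + \<epsilon>))"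
  proof -
    have "(1 - \<epsilon>) * (1 + \<epsilon>) \<le> 1" by (simp add: algebra_simps)
    then have "((1 - \<epsilon>) * (1 + \<epsilon>)) * ((1 - \<epsilon>) * real m * ?w\<^sup>2) \<le> 1 * ((1 - \<epsilon>) * real m * ?w\<^sup>2)"
      using \<epsilon> by (intro mult_right_mono) auto
    also have "\<dots> \<le> Z" using lo by (simp add: w2 Z_def)
    finally show ?thesis
      using pos by (simp add: le_divide_eq power_mult_distrib power2_eq_square mult_ac)
  qed
  then have "(1 - \<epsilon>) * ?w \<le> estimate d m \<epsilon> \<sigma> x y"
    unfolding est by (rule real_le_rsqrt)
  moreover have "max 0 (1 - 2 * \<epsilon>) * ?w \<le> (1 - \<epsilon>) * ?w"
    using \<epsilon> weight_nonneg by (intro mult_right_mono) auto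
  ultimately show ?thesis by (simp add: accurate_def)
qed

lemma accurate_failure:
  assumes \<epsilon>: "0 < \<epsilon>" "\<epsilon> < 1" and m: "0 < m" and "\<forall>x \<in> set xs. length x = d"
  shows "measure_pmf.prob (coins (m * d))
      {bs. \<not> (\<forall>x \<in> set xs. \<forall>y \<in> set ys. accurate d m \<epsilon> ((!) bs) x y)}
    \<le> 2 * real (length xs) * real (length ys) / (1 + \<epsilon>\<^sup>2 / 20) ^ m"
proof (rule order_trans[OF measure_pmf.finite_measure_mono
      sketch_failure[OF \<epsilon>, where u = "\<lambda>i t k. xs ! i ! k - ys ! t ! k"]])
  show "{bs. \<not> (\<forall>x \<in> set xs. \<forall>y \<in> set ys. accurate d m \<epsilon> ((!) bs) x y)} \<subseteq>
    {bs. \<not> (\<forall>i<length xs. \<forall>t<length ys.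
      (1 - \<epsilon>) * real m * (\<Sum>k<d. (xs ! i ! k - ys ! t ! k)\<^sup>2)
        \<le> (\<Sum>j<m. (sketch d ((!) bs) (\<lambda>k. xs ! i ! k - ys ! t ! k) j)\<^sup>2) \<and>
      (\<Sum>j<m. (sketch d ((!) bs) (\<lambda>k. xs ! i ! k - ys ! t ! k) j)\<^sup>2)
        \<le> (1 + \<epsilon>) * real m * (\<Sum>k<d. (xs ! i ! k - ys ! t ! k)\<^sup>2))}"
    using assms by (auto simp: in_set_conv_nth intro!: accurateI)
qed simp

section \<open>The update program\<close>

definition agree_except :: "nat set \<Rightarrow> nat set \<Rightarrow> store \<Rightarrow> store \<Rightarrow> bool" where
  "agree_except I R s s' \<longleftrightarrow> input s' = input s \<and>
     (\<forall>a. a \<notin> I \<longrightarrow> icell s' a = icell s a) \<and> (\<forall>a. a \<notin> R \<longrightarrow> rcell s' a = rcell s a)"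

lemma index_less: "i < n \<Longrightarrow> k < d \<Longrightarrow> i * d + k < n * (d :: nat)"
proof -
  assume "i < n" "k < d"
  then have "i * d + k < Suc i * d" "Suc i * d \<le> n * d" by (auto intro!: mult_le_mono1 simp del: mult_Suc) simp
  then show ?thesis by simp
qed

abbreviation "ireg x \<equiv> ICell (IConst x)"
abbreviation "rreg x \<equiv> RCell (IConst x)"
abbreviation "RConst k \<equiv> RNat (IConst k)"

text \<open>
  Natural cells: 0 holds the index of the matched point, 2 holds \<open>n\<close>, 1 holds \<open>d\<close>, 3 the sketch dimension \<open>m\<close>, 4 to 6 the loop
  counters; from 8 on, the sign matrix.  Real cells: 0 holds the value of the matching, 2 the best
  estimated gain, 3 the normalization \<open>m (1 + \<epsilon>)\<close>, 4 is an accumulator; from 8 on, the offline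
  points, their shares, the sketch of the current online point and the sketches of the offline points.
\<close>

abbreviation "ShareAddr i \<equiv> IAdd (IAdd (IConst 8) (IMul (ireg 2) (ireg 1))) i"
abbreviation "OnlineSketchAddr \<equiv> IAdd (IAdd (IConst 8) (IMul (ireg 2) (ireg 1))) (ireg 2)"
abbreviation "OfflineSketchAddr i \<equiv> IAdd (IAdd OnlineSketchAddr (ireg 3)) (IMul i (ireg 3))"
abbreviation "PointAddr i k \<equiv> IAdd (IConst 8) (IAdd (IMul i (ireg 1)) k)"

text \<open>Coins are stored as the naturals 0 and 1, so a sign is decoded as twice the cell minus
  1. Source and destination are expressions evaluated anew in each round, which lets the same code
  serve online and offline points.\<close>

definition Sketch :: "iexp \<Rightarrow> rexp \<Rightarrow> com" where
  "Sketch dst src = For 5 (ireg 3)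
     (Seq (Accumulate 6 (ireg 1)
        (RMul (RSub (RMul (RConst 2) (RNat (ICell (IAdd (IConst 8) (IAdd (IMul (ireg 5) (ireg 1)) (ireg 6))))))
           (RConst 1)) src))
        (RSet (IAdd dst (ireg 5)) (rreg 4)))"

text \<open>The premises on \<open>dst\<close> and \<open>src\<close> tolerate arbitrary changes of
  the real cells; this avoids describing the partially written sketch there, and it confines address
  computations to natural cells.\<close>

lemma ensures_Sketch:
  assumes S: "8 < S" "m < S" "d < S" "8 \<le> D" "D + m \<le> S"
    and s: "icell s 3 = m" "icell s 1 = d" "\<And>a. a < m * d \<Longrightarrow> icell s (8 + a) = of_bool (\<sigma> a)"
    and dst: "\<And>s'. agree_except {5, 6} UNIV s s' \<Longrightarrow> ival dst s' = D"
    and src: "\<And>s' k. k < d \<Longrightarrow> agree_except {5, 6} UNIV s s' \<Longrightarrow> icell s' 6 = k \<Longrightarrow> rval src s' = u k"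
    and Q: "\<And>s'. agree_except {5, 6} (insert 4 {D..<D + m}) s s' \<Longrightarrow>
      \<forall>j<m. rcell s' (D + j) = sketch d \<sigma> u j \<Longrightarrow> Q s'"
  shows "ensures S (m * (5 * d + 11) + 3) (Sketch dst src) s Q"
proof -
  let ?J = "\<lambda>k s'. agree_except {5, 6} (insert 4 {D..<D + m}) s s' \<and>
    (\<forall>j<k. rcell s' (D + j) = sketch d \<sigma> u j)"
  have "ensures S (m * (((d * 5 + 5) + 1 + 1) + 4) + 3) (Sketch dst src) s Q"
    unfolding Sketch_def
  proof (rule ensures_For[where I = ?J])
    fix j s1 assume j: "j < m" and J: "?J j s1" and 5: "icell s1 5 = j"
    have eq: "icell s1 3 = m" "icell s1 1 = d" "a < m * d \<Longrightarrow> icell s1 (8 + a) = of_bool (\<sigma> a)" for a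
      using J s by (auto simp: agree_except_def)
    let ?s2 = "s1\<lparr>icell := (icell s1)(6 := d), rcell := (rcell s1)(4 := sketch d \<sigma> u j)\<rparr>"
    have agree: "agree_except {5, 6} UNIV s (s1\<lparr>icell := (icell s1)(6 := k), rcell := r\<rparr>)" for k r
      using J by (auto simp: agree_except_def)
    show "ensures S ((d * 5 + 5) + 1 + 1) (Seq (Accumulate 6 (ireg 1)
        (RMul (RSub (RMul (RConst 2) (RNat (ICell (IAdd (IConst 8) (IAdd (IMul (ireg 5) (ireg 1)) (ireg 6))))))
           (RConst 1)) src)) (RSet (IAdd dst (ireg 5)) (rreg 4))) s1
        (\<lambda>s'. icell s' 5 = j \<and> ?J (Suc j) (s'\<lparr>icell := (icell s')(5 := Suc j)\<rparr>))"
    proof (rule ensures_Seq[where R = "\<lambda>s'. s' = ?s2"])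
      show "ensures S (d * 5 + 5) (Accumulate 6 (ireg 1)
        (RMul (RSub (RMul (RConst 2) (RNat (ICell (IAdd (IConst 8) (IAdd (IMul (ireg 5) (ireg 1)) (ireg 6))))))
           (RConst 1)) src)) s1 (\<lambda>s'. s' = ?s2)"
        using S eq 5 index_less[OF j, of _ d]
        by (intro ensures_Accumulate[where f = "\<lambda>k. signed (\<sigma> (j * d + k)) * u k"])
           (auto simp: sketch_def signed_def src agree)
      fix s2 assume s2: "s2 = ?s2"
      have D: "ival dst s2 = D" using dst[OF agree] by (simp add: s2)
      show "ensures S 1 (RSet (IAdd dst (ireg 5)) (rreg 4)) s2
        (\<lambda>s'. icell s' 5 = j \<and> ?J (Suc j) (s'\<lparr>icell := (icell s')(5 := Suc j)\<rparr>))"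
        using J j S 5 by (intro ensures_RSet) (auto simp: D, auto simp: s2 agree_except_def less_Suc_eq)
    qed
  qed (use S s Q in \<open>auto simp: agree_except_def\<close>)
  then show ?thesis by (rule ensures_mono) (auto simp: algebra_simps)
qed

text \<open>The shares \<open>v\<close> and the value \<open>A\<close> are parameters not tied to
  any matching, so that programs can be verified without mentioning sessions. The block of the
  online sketch is left out as scratch space.\<close>

definition represents ::
  "nat \<Rightarrow> nat \<Rightarrow> nat \<Rightarrow> real \<Rightarrow> (nat \<Rightarrow> bool) \<Rightarrow> real list list \<Rightarrow> (nat \<Rightarrow> real) \<Rightarrow> real \<Rightarrow> store \<Rightarrow> bool" where
  "represents n d m \<epsilon> \<sigma> xs v A s \<longleftrightarrow>
     icell s 1 = d \<and> icell s 2 = n \<and> icell s 3 = m \<and> (\<forall>a<m * d. icell s (8 + a) = of_bool (\<sigma> a)) \<and>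
     rcell s 0 = A \<and> rcell s 3 = real m * (1 + \<epsilon>) \<and>
     (\<forall>i<n. \<forall>k<d. rcell s (8 + (i * d + k)) = xs ! i ! k) \<and>
     (\<forall>i<n. rcell s (8 + n * d + i) = v i) \<and>
     (\<forall>i<n. \<forall>j<m. rcell s (8 + n * d + n + m + i * m + j) = sketch d \<sigma> ((!) (xs ! i)) j)"

text \<open>The exempted cells are scratch: matched index, loop counters, best gain, accumulator and
  online sketch, all disjoint from the persistent layout.\<close>

lemma represents_agree:
  assumes "represents n d m \<epsilon> \<sigma> xs v A s" "agree_except {0, 4, 5, 6} ({2, 4} \<union> {8 + n * d + n..<8 + n * d + n + m}) s s'"
  shows "represents n d m \<epsilon> \<sigma> xs v A s'"
proof -
  have "rcell s' (8 + (i * d + k)) = rcell s (8 + (i * d + k))" if "i < n" "k < d" for i k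
    using index_less[OF that] assms(2) by (simp add: agree_except_def)
  then show ?thesis
    using assms unfolding represents_def by (simp add: agree_except_def)
qed

definition EstimateGain :: com where
  "EstimateGain =
     Seq (Accumulate 5 (ireg 3)
        (RMul (RSub (RCell (IAdd (OfflineSketchAddr (ireg 4)) (ireg 5))) (RCell (IAdd OnlineSketchAddr (ireg 5))))
              (RSub (RCell (IAdd (OfflineSketchAddr (ireg 4)) (ireg 5))) (RCell (IAdd OnlineSketchAddr (ireg 5))))))
       (RSet (IConst 4) (RSub (RSqrt (RDiv (rreg 4) (rreg 3))) (RCell (ShareAddr (ireg 4)))))"

lemma ensures_EstimateGain:
  assumes "8 < S" "m < S" and s: "represents n d m \<epsilon> \<sigma> xs v A s" "icell s 4 = i" "i < n"
    and y: "\<And>j. j < m \<Longrightarrow> rcell s (8 + n * d + n + j) = sketch d \<sigma> ((!) y) j"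
    and Q: "Q (s\<lparr>icell := (icell s)(5 := m),
      rcell := (rcell s)(4 := estimate d m \<epsilon> \<sigma> (xs ! i) y - v i)\<rparr>)"
  shows "ensures S (m * 5 + 7) EstimateGain s Q"
proof -
  let ?s = "s\<lparr>icell := (icell s)(5 := m), rcell := (rcell s)(4 :=
    \<Sum>j<m. (sketch d \<sigma> ((!) (xs ! i)) j - sketch d \<sigma> ((!) y) j)\<^sup>2)\<rparr>"
  have "ensures S ((m * 5 + 5) + 1 + 1) EstimateGain s Q"
    unfolding EstimateGain_def
  proof (rule ensures_Seq[where R = "\<lambda>s'. s' = ?s"])
    show "ensures S (m * 5 + 5) (Accumulate 5 (ireg 3)
        (RMul (RSub (RCell (IAdd (OfflineSketchAddr (ireg 4)) (ireg 5))) (RCell (IAdd OnlineSketchAddr (ireg 5))))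
              (RSub (RCell (IAdd (OfflineSketchAddr (ireg 4)) (ireg 5))) (RCell (IAdd OnlineSketchAddr (ireg 5))))))
        s (\<lambda>s'. s' = ?s)"
      using assms by (intro ensures_Accumulate) (auto simp: represents_def power2_eq_square)
    show "ensures S 1 (RSet (IConst 4) (RSub (RSqrt (RDiv (rreg 4) (rreg 3))) (RCell (ShareAddr (ireg 4))))) s' Q"
      if "s' = ?s" for s'
      using assms that by (intro ensures_RSet) (auto simp: represents_def estimate_def)
  qed
  then show ?thesis by (rule ensures_mono) auto
qed

text \<open>Starting from index 0 with gain 0 guarantees a valid index even if every estimated gain
  is nonpositive.\<close>

definition FindBest :: com where
  "FindBest =
     Seq (ISet (IConst 0) (IConst 0))
    (Seq (RSet (IConst 2) (RConst 0))
    (For 4 (ireg 2)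
       (Seq EstimateGain
         (If (RLess (rreg 2) (rreg 4)) (Seq (ISet (IConst 0) (ireg 4)) (RSet (IConst 2) (rreg 4))) Skip))))"

lemma ensures_FindBest:
  assumes S: "8 < S" "m < S" "n < S" and n: "0 < n" and s: "represents n d m \<epsilon> \<sigma> xs v A s"
    and y: "\<And>j. j < m \<Longrightarrow> rcell s (8 + n * d + n + j) = sketch d \<sigma> ((!) y) j"
    and Q: "\<And>s' b r. agree_except {0, 4, 5} {2, 4} s s' \<Longrightarrow> icell s' 0 = b \<Longrightarrow> b < n \<Longrightarrow>
      r \<le> max 0 (estimate d m \<epsilon> \<sigma> (xs ! b) y - v b) \<Longrightarrow>
      \<forall>i<n. estimate d m \<epsilon> \<sigma> (xs ! i) y - v i \<le> r \<Longrightarrow> Q s'"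
  shows "ensures S (n * (m * 5 + 16) + 7) FindBest s Q"
proof -
  let ?g = "\<lambda>i. estimate d m \<epsilon> \<sigma> (xs ! i) y - v i"
  \<comment> \<open>The recorded gain is initially 0, which need not be the gain of point 0; hence
    the bound by \<open>max 0\<close> of the gain rather than equality.\<close>
  let ?J = "\<lambda>k s'. agree_except {0, 4, 5} {2, 4} s s' \<and> icell s' 0 < n \<and>
    rcell s' 2 \<le> max 0 (?g (icell s' 0)) \<and> (\<forall>i<k. ?g i \<le> rcell s' 2)"
  have "ensures S (1 + (1 + (n * (((m * 5 + 7) + ((1 + 1 + 1) + 1) + 1) + 4) + 3) + 1) + 1) FindBest s Q"
    unfolding FindBest_def
  proof (rule ensures_Seq[where R = "\<lambda>s'. s' = s\<lparr>icell := (icell s)(0 := 0)\<rparr>"])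
    fix s1 assume s1: "s1 = s\<lparr>icell := (icell s)(0 := 0)\<rparr>"
    show "ensures S (1 + (n * (((m * 5 + 7) + ((1 + 1 + 1) + 1) + 1) + 4) + 3) + 1)
      (Seq (RSet (IConst 2) (RConst 0)) (For 4 (ireg 2)
       (Seq EstimateGain
         (If (RLess (rreg 2) (rreg 4)) (Seq (ISet (IConst 0) (ireg 4)) (RSet (IConst 2) (rreg 4))) Skip)))) s1 Q"
    proof (rule ensures_Seq[where R = "\<lambda>s'. s' = s1\<lparr>rcell := (rcell s)(2 := 0)\<rparr>"])
      fix s2 assume s2: "s2 = s1\<lparr>rcell := (rcell s)(2 := 0)\<rparr>"
      show "ensures S (n * (((m * 5 + 7) + ((1 + 1 + 1) + 1) + 1) + 4) + 3) (For 4 (ireg 2)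
         (Seq EstimateGain
           (If (RLess (rreg 2) (rreg 4)) (Seq (ISet (IConst 0) (ireg 4)) (RSet (IConst 2) (rreg 4))) Skip))) s2 Q"
      proof (rule ensures_For[where I = ?J])
        fix i s3 assume i: "i < n" and J: "?J i s3" and 4: "icell s3 4 = i"
        have rep: "represents n d m \<epsilon> \<sigma> xs v A s3"
          using J by (intro represents_agree[OF s]) (auto simp: agree_except_def)
        have y3: "rcell s3 (8 + n * d + n + j) = sketch d \<sigma> ((!) y) j" if "j < m" for j
          using J y[OF that] by (auto simp: agree_except_def)
        let ?s4 = "s3\<lparr>icell := (icell s3)(5 := m), rcell := (rcell s3)(4 := ?g i)\<rparr>"
        show "ensures S ((m * 5 + 7) + ((1 + 1 + 1) + 1) + 1) (Seq EstimateGain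
            (If (RLess (rreg 2) (rreg 4)) (Seq (ISet (IConst 0) (ireg 4)) (RSet (IConst 2) (rreg 4))) Skip)) s3
          (\<lambda>s'. icell s' 4 = i \<and> ?J (Suc i) (s'\<lparr>icell := (icell s')(4 := Suc i)\<rparr>))"
        proof (rule ensures_Seq[where R = "\<lambda>s'. s' = ?s4"])
          show "ensures S (m * 5 + 7) EstimateGain s3 (\<lambda>s'. s' = ?s4)"
            using S rep 4 i y3 by (intro ensures_EstimateGain) auto
          fix s4 assume s4: "s4 = ?s4"
          show "ensures S ((1 + 1 + 1) + 1)
            (If (RLess (rreg 2) (rreg 4)) (Seq (ISet (IConst 0) (ireg 4)) (RSet (IConst 2) (rreg 4))) Skip) s4
            (\<lambda>s'. icell s' 4 = i \<and> ?J (Suc i) (s'\<lparr>icell := (icell s')(4 := Suc i)\<rparr>))"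
          proof (rule ensures_If)
            assume h: "holds (RLess (rreg 2) (rreg 4)) s4"
            show "ensures S (1 + 1 + 1) (Seq (ISet (IConst 0) (ireg 4)) (RSet (IConst 2) (rreg 4))) s4
              (\<lambda>s'. icell s' 4 = i \<and> ?J (Suc i) (s'\<lparr>icell := (icell s')(4 := Suc i)\<rparr>))"
            proof (rule ensures_Seq[where R = "\<lambda>s'. s' = s4\<lparr>icell := (icell s4)(0 := i)\<rparr>"])
              show "ensures S 1 (ISet (IConst 0) (ireg 4)) s4 (\<lambda>s'. s' = s4\<lparr>icell := (icell s4)(0 := i)\<rparr>)"
                using S i 4 by (intro ensures_ISet) (auto simp: s4)
              fix s5 assume "s5 = s4\<lparr>icell := (icell s4)(0 := i)\<rparr>"
              then show "ensures S 1 (RSet (IConst 2) (rreg 4)) s5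
                (\<lambda>s'. icell s' 4 = i \<and> ?J (Suc i) (s'\<lparr>icell := (icell s')(4 := Suc i)\<rparr>))"
                using S i 4 h J
                by (intro ensures_RSet) (auto simp: s4 agree_except_def less_Suc_eq intro: less_imp_le order.trans)
            qed
          next
            assume "\<not> holds (RLess (rreg 2) (rreg 4)) s4"
            then show "ensures S (1 + 1 + 1) Skip s4
              (\<lambda>s'. icell s' 4 = i \<and> ?J (Suc i) (s'\<lparr>icell := (icell s')(4 := Suc i)\<rparr>))"
              using S i 4 J by (intro ensures_Skip) (auto simp: s4 agree_except_def less_Suc_eq)
          qed
        qed
      next
        fix s' assume "?J n s'"
        then show "Q s'" using Q[of s' "icell s' 0" "rcell s' 2"] by auto
      qed (use S s n in \<open>auto simp: s1 s2 agree_except_def represents_def\<close>)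
    qed (use S in \<open>auto simp: s1 intro!: ensures_RSet\<close>)
  qed (use S in \<open>auto intro!: ensures_ISet\<close>)
  then show ?thesis by (rule ensures_mono) (auto simp: algebra_simps)
qed

text \<open>The only exact distance is computed here. The value grows by the difference to the old
  share, so it must be written before the share is overwritten.\<close>

definition Commit :: com where
  "Commit =
     Seq (Accumulate 6 (ireg 1)
       (RMul (RSub (RCell (PointAddr (ireg 0) (ireg 6))) (RInput (ireg 6)))
             (RSub (RCell (PointAddr (ireg 0) (ireg 6))) (RInput (ireg 6)))))
    (Seq (RSet (IConst 4) (RSqrt (rreg 4)))
      (If (RLess (RCell (ShareAddr (ireg 0))) (rreg 4))
         (Seq (RSet (IConst 0) (RAdd (rreg 0) (RSub (rreg 4) (RCell (ShareAddr (ireg 0))))))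
              (RSet (ShareAddr (ireg 0)) (rreg 4)))
         Skip))"

lemma ensures_Commit:
  assumes S: "8 < S" "d < S" "8 + n * d + n \<le> S" and s: "represents n d m \<epsilon> \<sigma> xs v A s"
    and b: "icell s 0 = b" "b < n" and x: "length (xs ! b) = d" and y: "input s = buffer y" "length y = d"
    and Q: "\<And>s'. icell s' 0 = b \<Longrightarrow> represents n d m \<epsilon> \<sigma> xs (v(b := max (v b) (weight (xs ! b) y)))
       (A + (max (v b) (weight (xs ! b) y) - v b)) s' \<Longrightarrow> Q s'"
  shows "ensures S (d * 5 + 12) Commit s Q"
proof -
  let ?w = "weight (xs ! b) y"
  let ?s1 = "s\<lparr>icell := (icell s)(6 := d), rcell := (rcell s)(4 := ?w\<^sup>2)\<rparr>"
  let ?s2 = "s\<lparr>icell := (icell s)(6 := d), rcell := (rcell s)(4 := ?w)\<rparr>"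
  let ?s3 = "s\<lparr>icell := (icell s)(6 := d), rcell := (rcell s)(4 := ?w, 0 := A + (?w - v b))\<rparr>"
  let ?s4 = "s\<lparr>icell := (icell s)(6 := d), rcell := (rcell s)(4 := ?w, 0 := A + (?w - v b), 8 + n * d + b := ?w)\<rparr>"
  have w2: "?w\<^sup>2 = (\<Sum>k<d. (xs ! b ! k - y ! k)\<^sup>2)"
    by (simp add: weight_def L2_set_def x sum_nonneg)
  have ne: "8 + (i * d + k) \<noteq> 8 + n * d + b" if "i < n" "k < d" for i k
    using index_less[OF that] by simp
  let ?test = "If (RLess (RCell (ShareAddr (ireg 0))) (rreg 4))
         (Seq (RSet (IConst 0) (RAdd (rreg 0) (RSub (rreg 4) (RCell (ShareAddr (ireg 0))))))
              (RSet (ShareAddr (ireg 0)) (rreg 4)))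
         Skip"
  have "ensures S ((d * 5 + 5) + (1 + ((1 + 1 + 1) + 1) + 1) + 1) Commit s Q"
    unfolding Commit_def
  proof (rule ensures_Seq[where R = "\<lambda>s'. s' = ?s1"])
    show "ensures S (d * 5 + 5) (Accumulate 6 (ireg 1)
       (RMul (RSub (RCell (PointAddr (ireg 0) (ireg 6))) (RInput (ireg 6)))
             (RSub (RCell (PointAddr (ireg 0) (ireg 6))) (RInput (ireg 6))))) s (\<lambda>s'. s' = ?s1)"
      using S s b y by (intro ensures_Accumulate[where f = "\<lambda>k. (xs ! b ! k - y ! k)\<^sup>2"])
        (auto simp: represents_def buffer_def power2_eq_square w2[unfolded power2_eq_square])
    fix s1 assume s1: "s1 = ?s1"
    show "ensures S (1 + ((1 + 1 + 1) + 1) + 1) (Seq (RSet (IConst 4) (RSqrt (rreg 4))) ?test) s1 Q"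
    proof (rule ensures_Seq[where R = "\<lambda>s'. s' = ?s2"])
      show "ensures S 1 (RSet (IConst 4) (RSqrt (rreg 4))) s1 (\<lambda>s'. s' = ?s2)"
        using S weight_nonneg by (intro ensures_RSet) (auto simp: s1)
      fix s2 assume s2: "s2 = ?s2"
      have v: "rcell s (8 + n * d + b) = v b" using s b by (simp add: represents_def)
      show "ensures S ((1 + 1 + 1) + 1) ?test s2 Q"
      proof (rule ensures_If)
        assume "holds (RLess (RCell (ShareAddr (ireg 0))) (rreg 4)) s2"
        then have less: "v b < ?w" using s b v by (simp add: s2 represents_def)
        show "ensures S (1 + 1 + 1) (Seq (RSet (IConst 0) (RAdd (rreg 0) (RSub (rreg 4) (RCell (ShareAddr (ireg 0))))))
              (RSet (ShareAddr (ireg 0)) (rreg 4))) s2 Q"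
        proof (rule ensures_Seq[where R = "\<lambda>s'. s' = ?s3"])
          show "ensures S 1 (RSet (IConst 0) (RAdd (rreg 0) (RSub (rreg 4) (RCell (ShareAddr (ireg 0)))))) s2
              (\<lambda>s'. s' = ?s3)"
            using S s b v by (intro ensures_RSet) (auto simp: s2 represents_def)
          have "represents n d m \<epsilon> \<sigma> xs (v(b := max (v b) ?w)) (A + (max (v b) ?w - v b)) ?s4"
            using s less ne b(2) by (auto simp: represents_def)
          then show "ensures S 1 (RSet (ShareAddr (ireg 0)) (rreg 4)) s3 Q" if "s3 = ?s3" for s3
            using S s b by (intro ensures_RSet) (auto simp: that represents_def intro!: Q)
        qed
      next
        assume "\<not> holds (RLess (RCell (ShareAddr (ireg 0))) (rreg 4)) s2"
        then have "max (v b) ?w = v b" using s b v by (simp add: s2 represents_def)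
        moreover have "represents n d m \<epsilon> \<sigma> xs v A s2"
          by (rule represents_agree[OF s]) (auto simp: s2 agree_except_def)
        ultimately show "ensures S (1 + 1 + 1) Skip s2 Q"
          using b by (intro ensures_Skip Q) (auto simp: s2)
      qed
    qed
  qed
  then show ?thesis by (rule ensures_mono) auto
qed

definition UpdateOp :: com where
  "UpdateOp = Seq (Sketch OnlineSketchAddr (RInput (ireg 6))) (Seq FindBest Commit)"

lemma ensures_UpdateOp:
  assumes S: "8 + n + d + m + n * d + n * m + m * d < S" and n: "0 < n"
    and xs: "length xs = n" "\<forall>x \<in> set xs. length x = d"
    and s: "represents n d m \<epsilon> \<sigma> xs v A s" and y: "input s = buffer y" "length y = d"
    and Q: "\<And>s' b r. icell s' 0 = b \<Longrightarrow> b < n \<Longrightarrow>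
      r \<le> max 0 (estimate d m \<epsilon> \<sigma> (xs ! b) y - v b) \<Longrightarrow>
      \<forall>i<n. estimate d m \<epsilon> \<sigma> (xs ! i) y - v i \<le> r \<Longrightarrow>
      represents n d m \<epsilon> \<sigma> xs (v(b := max (v b) (weight (xs ! b) y)))
       (A + (max (v b) (weight (xs ! b) y) - v b)) s' \<Longrightarrow> Q s'"
  shows "ensures S (m * (5 * d + 11) + n * (m * 5 + 16) + d * 5 + 24) UpdateOp s Q"
proof -
  let ?D = "8 + n * d + n"
  let ?R = "\<lambda>s'. agree_except {5, 6} (insert 4 {?D..<?D + m}) s s' \<and>
      (\<forall>j<m. rcell s' (?D + j) = sketch d \<sigma> ((!) y) j)"
  let ?R2 = "\<lambda>s'. represents n d m \<epsilon> \<sigma> xs v A s' \<and> input s' = buffer y \<and>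
      icell s' 0 < n \<and> (\<exists>r. r \<le> max 0 (estimate d m \<epsilon> \<sigma> (xs ! icell s' 0) y - v (icell s' 0)) \<and>
      (\<forall>i<n. estimate d m \<epsilon> \<sigma> (xs ! i) y - v i \<le> r))"
  have "ensures S ((m * (5 * d + 11) + 3) + ((n * (m * 5 + 16) + 7) + (d * 5 + 12) + 1) + 1) UpdateOp s Q"
    unfolding UpdateOp_def
  proof (rule ensures_Seq[where R = ?R])
    show "ensures S (m * (5 * d + 11) + 3) (Sketch OnlineSketchAddr (RInput (ireg 6))) s ?R"
      using S s y by (intro ensures_Sketch[where D = ?D])
        (auto simp: represents_def agree_except_def buffer_def)
    fix s1 assume s1: "?R s1"
    have rep1: "represents n d m \<epsilon> \<sigma> xs v A s1"
      using s1 by (intro represents_agree[OF s]) (auto simp: agree_except_def)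
    have in1: "input s1 = buffer y" using s1 y by (simp add: agree_except_def)
    show "ensures S ((n * (m * 5 + 16) + 7) + (d * 5 + 12) + 1) (Seq FindBest Commit) s1 Q"
    proof (rule ensures_Seq[where R = ?R2])
      show "ensures S (n * (m * 5 + 16) + 7) FindBest s1 ?R2"
      proof (rule ensures_FindBest[OF _ _ _ n rep1])
        fix s2 b r assume *: "agree_except {0, 4, 5} {2, 4} s1 s2" "icell s2 0 = b" "b < n"
          "r \<le> max 0 (estimate d m \<epsilon> \<sigma> (xs ! b) y - v b)"
          "\<forall>i<n. estimate d m \<epsilon> \<sigma> (xs ! i) y - v i \<le> r"
        moreover have "represents n d m \<epsilon> \<sigma> xs v A s2"
          using *(1) by (intro represents_agree[OF rep1]) (auto simp: agree_except_def)
        moreover have "input s2 = buffer y" using *(1) in1 by (simp add: agree_except_def)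
        ultimately show "?R2 s2" by auto
      qed (use S s1 in auto)
      fix s2 assume "?R2 s2"
      then show "ensures S (d * 5 + 12) Commit s2 Q"
        using S xs y by (intro ensures_Commit[where b = "icell s2 0" and v = v and A = A and y = y]) (auto intro: Q)
    qed
  qed
  then show ?thesis by (rule ensures_mono) auto
qed

section \<open>The initialization program\<close>

text \<open>The inequality says that the failure bound for \<open>n\<close> offline and
  \<open>n\<close> online points is at most \<open>\<delta>\<close>. It avoids logarithms and
  division by the power, and the loop of \<open>Prepare\<close> tests exactly its negation.\<close>

definition sketch_dim :: "nat \<Rightarrow> real \<Rightarrow> real \<Rightarrow> nat" where
  "sketch_dim n \<epsilon> \<delta> = (LEAST m. 2 * (real n * real n) \<le> (1 + \<epsilon>\<^sup>2 / 20) ^ m * \<delta>)"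

lemma sketch_dim:
  assumes "0 < \<epsilon>" "0 < \<delta>"
  shows "2 * (real n * real n) \<le> (1 + \<epsilon>\<^sup>2 / 20) ^ sketch_dim n \<epsilon> \<delta> * \<delta>"
    and "k < sketch_dim n \<epsilon> \<delta> \<Longrightarrow> (1 + \<epsilon>\<^sup>2 / 20) ^ k * \<delta> < 2 * (real n * real n)"
proof -
  have "1 < 1 + \<epsilon>\<^sup>2 / 20" using assms by simp
  then obtain m where "2 * (real n * real n) / \<delta> < (1 + \<epsilon>\<^sup>2 / 20) ^ m"
    using real_arch_pow by blast
  then have "2 * (real n * real n) \<le> (1 + \<epsilon>\<^sup>2 / 20) ^ m * \<delta>"
    using assms by (simp add: divide_less_eq)
  then show "2 * (real n * real n) \<le> (1 + \<epsilon>\<^sup>2 / 20) ^ sketch_dim n \<epsilon> \<delta> * \<delta>"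
    unfolding sketch_dim_def by (rule LeastI)
  show "(1 + \<epsilon>\<^sup>2 / 20) ^ k * \<delta> < 2 * (real n * real n)" if "k < sketch_dim n \<epsilon> \<delta>"
    using that not_less_Least unfolding sketch_dim_def by fastforce
qed

lemma sketch_dim_pos:
  assumes "0 < \<epsilon>" "0 < \<delta>" "\<delta> < 1" "1 \<le> n"
  shows "0 < sketch_dim n \<epsilon> \<delta>"
proof (rule ccontr)
  assume "\<not> 0 < sketch_dim n \<epsilon> \<delta>"
  then have "2 * (real n * real n) \<le> \<delta>" using sketch_dim(1)[of \<epsilon> \<delta> n] assms by simp
  moreover have "1 * 1 \<le> real n * real n" using assms by (intro mult_mono) auto
  ultimately show False using assms by simp
qed

text \<open>By minimality the exponent \<open>?m - 1\<close> fails the test, and logarithms bound it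
  by \<open>3 * ?L\<close> over \<open>ln (1 + e)\<close>. This gives 120; the other 2 pay for the
  one remaining row, since \<open>?L\<close> is at least 1/2 in \<open>regime\<close>.\<close>

lemma sketch_dim_le:
  assumes "(n, d, \<epsilon>, \<delta>) \<in> regime"
  shows "real (sketch_dim n \<epsilon> \<delta>) \<le> 122 * (1 / \<epsilon>\<^sup>2 * ln (real n / \<delta>))"
proof -
  let ?m = "sketch_dim n \<epsilon> \<delta>" and ?L = "ln (real n / \<delta>)"
  define e where "e = \<epsilon>\<^sup>2 / 20"
  have p: "1 \<le> n" "0 < \<epsilon>" "\<epsilon> < 1" "0 < \<delta>" "\<delta> < 1" "2 \<le> real n / \<delta>"
    using assms by (auto simp: regime_def valid_params_def)
  have \<epsilon>2: "0 < \<epsilon>\<^sup>2" "\<epsilon>\<^sup>2 < 1" using p by (auto simp: power_less_one_iff)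
  have e: "0 < e" "e \<le> 1/20" using \<epsilon>2 by (auto simp: e_def)
  have m: "0 < ?m" using sketch_dim_pos p by simp
  have q: "0 < real n / \<delta>" using p by simp
  have "ln (1/2) \<le> 1/2 - (1 :: real)" by (rule ln_le_minus_one) simp
  then have "1/2 \<le> ln (2 :: real)" by (simp add: ln_div)
  also have "\<dots> \<le> ?L" using p(6) by (subst ln_le_cancel_iff) auto
  finally have L: "1/2 \<le> ?L" .
  have "e / 2 \<le> e - e\<^sup>2" using e by (simp add: power2_eq_square)
  also have "\<dots> \<le> ln (1 + e)" using e by (intro ln_one_plus_pos_lower_bound) auto
  finally have ln_e: "e / 2 \<le> ln (1 + e)" .
  have "(1 + e) ^ (?m - 1) * \<delta> < 2 * (real n * real n)"
    unfolding e_def using m p by (intro sketch_dim(2)) auto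
  then have "(1 + e) ^ (?m - 1) < 2 * (real n * real n) / \<delta>" using p by (simp add: less_divide_eq)
  \<comment> \<open>The regime condition lets one factor absorb the 2, and
    \<open>\<delta> < 1\<close> bounds the rest by the square of
    \<open>real n / \<delta>\<close>.\<close>
  also have "\<dots> \<le> (real n / \<delta>) * ((real n / \<delta>) * (real n / \<delta>))"
  proof -
    have "real n * real n / \<delta> \<le> (real n / \<delta>) * (real n / \<delta>)"
      using p by (simp add: field_simps)
    then have "2 * (real n * real n / \<delta>) \<le> (real n / \<delta>) * ((real n / \<delta>) * (real n / \<delta>))"
      using p(4,6) q by (intro mult_mono) auto
    then show ?thesis by simp
  qed
  also have "\<dots> = (real n / \<delta>) ^ 3" by (simp only: power3_eq_cube mult.assoc)
  finally have "ln ((1 + e) ^ (?m - 1)) \<le> ln ((real n / \<delta>) ^ 3)"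
    using e by (intro ln_mono) (auto intro!: zero_less_power)
  moreover have "ln ((1 + e) ^ (?m - 1)) = real (?m - 1) * ln (1 + e)"
    by (rule ln_realpow)
  moreover have "ln ((real n / \<delta>) ^ 3) = 3 * ?L" using ln_realpow[of "real n / \<delta>" 3] by simp
  ultimately have "real (?m - 1) * ln (1 + e) \<le> 3 * ?L" by linarith
  moreover have "real (?m - 1) * (e / 2) \<le> real (?m - 1) * ln (1 + e)"
    using ln_e by (intro mult_left_mono) auto
  ultimately have "real (?m - 1) * (e / 2) \<le> 3 * ?L" by simp
  then have "real (?m - 1) \<le> 120 * (1 / \<epsilon>\<^sup>2 * ?L)" using \<epsilon>2 by (simp add: e_def field_simps)
  moreover have "1 \<le> 2 * (1 / \<epsilon>\<^sup>2 * ?L)" using \<epsilon>2 L by (simp add: field_simps)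
  ultimately show ?thesis using m by simp
qed

text \<open>\<open>n\<close> is copied to cell 2 because updates announce their match in cell 0.
  Real cell 4 holds the current power and natural cell 3 its exponent, which is 0 in the empty
  memory.\<close>

definition Prepare :: com where
  "Prepare =
     Seq (ISet (IConst 2) (ireg 0))
    (Seq (RSet (IConst 4) (RConst 1))
    (Seq (While (RLess (RMul (rreg 4) (RInput (IConst 1))) (RMul (RConst 2) (RMul (RNat (ireg 0)) (RNat (ireg 0)))))
       (Seq (RSet (IConst 4) (RMul (rreg 4) (RAdd (RConst 1)
              (RDiv (RMul (RInput (IConst 0)) (RInput (IConst 0))) (RConst 20)))))
            (ISet (IConst 3) (IAdd (ireg 3) (IConst 1)))))
      (RSet (IConst 3) (RMul (RNat (ireg 3)) (RAdd (RConst 1) (RInput (IConst 0)))))))"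

text \<open>The zeros in the other real cells are recorded because the value and the shares start at
  0 without any code that writes them.\<close>

definition prepared :: "nat \<Rightarrow> nat \<Rightarrow> nat \<Rightarrow> real \<Rightarrow> store \<Rightarrow> store \<Rightarrow> bool" where
  "prepared n d m \<epsilon> s s' \<longleftrightarrow> input s' = input s \<and> icell s' 1 = d \<and> icell s' 2 = n \<and> icell s' 3 = m \<and>
     rcell s' 3 = real m * (1 + \<epsilon>) \<and> (\<forall>a. a \<notin> {3, 4} \<longrightarrow> rcell s' a = 0)"

lemma ensures_Prepare:
  assumes S: "8 < S" "n < S" "m < S" and p: "0 < \<epsilon>" "0 < \<delta>" and m: "m = sketch_dim n \<epsilon> \<delta>"
  shows "ensures S (m * 5 + 8) Prepare (init_store n d \<epsilon> \<delta> xs)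
    (prepared n d m \<epsilon> (init_store n d \<epsilon> \<delta> xs))"
proof -
  let ?init = "init_store n d \<epsilon> \<delta> xs"
  let ?s = "\<lambda>k. ?init\<lparr>icell := (icell ?init)(2 := n, 3 := k), rcell := (rcell ?init)(4 := (1 + \<epsilon>\<^sup>2 / 20) ^ k)\<rparr>"
  have s0: "icell ?init 0 = n" "icell ?init (Suc 0) = d" "icell ?init 3 = 0" "input ?init 0 = \<epsilon>" "input ?init (Suc 0) = \<delta>"
    "rcell ?init = (\<lambda>_. 0)"
    by (auto simp: init_store_def buffer_def)
  have "ensures S (1 + (1 + ((m * ((1 + 1 + 1) + 2) + 1) + 1 + 1) + 1) + 1) Prepare ?init (prepared n d m \<epsilon> ?init)"
    unfolding Prepare_def
  proof (rule ensures_Seq[where R = "\<lambda>s'. s' = ?init\<lparr>icell := (icell ?init)(2 := n)\<rparr>"],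
      goal_cases)
    case 1
    show ?case using S s0 by (intro ensures_ISet) auto
  next
    case (2 s1)
    show ?case
    proof (rule ensures_Seq[where R = "\<lambda>s'. s' = ?s 0"], goal_cases)
      case 1
      show ?case using S s0 2 by (intro ensures_RSet) (auto simp: fun_upd_idem)
    next
      case (2 s2)
      show ?case
      proof (rule ensures_Seq[where R = "\<lambda>s'. s' = ?s m"], goal_cases)
        case 1
        show ?case
        \<comment> \<open>With \<open>k\<close> rounds left the exponent is \<open>m - k\<close>;
          minimality of \<open>m\<close> makes the test succeed before that, so the loop stops
          exactly at \<open>sketch_dim\<close>.\<close>
        proof (rule ensures_While[where I = "\<lambda>k s'. k \<le> m \<and> s' = ?s (m - k)"], goal_cases)
          case 1
          then show ?case using 2 by simp
        next
          case (2 k s3)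
          then have s3: "s3 = ?s (m - Suc k)" and k: "k < m" by auto
          have "(1 + \<epsilon>\<^sup>2 / 20) ^ (m - Suc k) * \<delta> < 2 * (real n * real n)"
            using k p unfolding m by (intro sketch_dim(2)) auto
          moreover have "ensures S (1 + 1 + 1) (Seq (RSet (IConst 4) (RMul (rreg 4) (RAdd (RConst 1)
                (RDiv (RMul (RInput (IConst 0)) (RInput (IConst 0))) (RConst 20)))))
              (ISet (IConst 3) (IAdd (ireg 3) (IConst 1)))) s3 (\<lambda>s'. k \<le> m \<and> s' = ?s (m - k))"
          proof (rule ensures_Seq[where R = "\<lambda>s'. s' = s3\<lparr>rcell := (rcell ?init)(4 := (1 + \<epsilon>\<^sup>2 / 20) ^ (m - k))\<rparr>"],
              goal_cases)
            case 1
            have "m - k = Suc (m - Suc k)" using k by simp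
            then show ?case
              using S s0 s3 by (intro ensures_RSet) (auto simp: power2_eq_square mult.commute)
          next
            case (2 s4)
            then show ?case using S s0 s3 k by (intro ensures_ISet) (auto simp: Suc_diff_Suc)
          qed
          ultimately show ?case using s0 s3 by simp
        next
          case (3 s3)
          then show ?case using sketch_dim(1)[OF p, of n] s0 by (simp add: m not_less)
        qed
      next
        case (2 s3)
        then show ?case using S s0 by (intro ensures_RSet) (auto simp: prepared_def)
      qed
    qed
  qed
  then show ?thesis by (rule ensures_mono) auto
qed

section \<open>Drawing the sign matrix\<close>

definition FlipSigns :: com where
  "FlipSigns = For 4 (IMul (ireg 3) (ireg 1)) (Flip (IAdd (IConst 8) (ireg 4)))"

text \<open>The store left by the loop if it is entered with counter \<open>i\<close> and the
  remaining coins fall as \<open>bs\<close>; this closed form makes the result distribution an image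
  of \<open>coins\<close>.\<close>

definition with_signs :: "nat \<Rightarrow> nat \<Rightarrow> store \<Rightarrow> bool list \<Rightarrow> store" where
  "with_signs N i s bs = s\<lparr>icell := \<lambda>a. if 8 + i \<le> a \<and> a < 8 + N then of_bool (bs ! (a - 8 - i))
      else if a = 4 then N else icell s a\<rparr>"

lemma evaluates_Flip:
  assumes "fits S s" "ival a s < S" "1 < S"
  shows "evaluates S 1 (Flip a) s
    (map_pmf (\<lambda>b. s\<lparr>icell := (icell s)(ival a s := of_bool b)\<rparr>) (bernoulli_pmf (1/2)))"
proof -
  have "evaluates S (Suc 0) (Flip a) s (bind_pmf (step (Flip a) s) (\<lambda>(_, s'). return_pmf s'))"
    using assms by (intro evaluates.move) (auto intro!: evaluates.halt fits_ISet)
  then show ?thesis by (simp add: map_pmf_def bind_assoc_pmf bind_return_pmf)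
qed

lemma evaluates_FlipSigns_loop:
  assumes "fits S s" "icell s 3 = m" "icell s 1 = d" "icell s 4 + r = m * d" "8 + m * d < S"
  shows "evaluates S (r * 5 + 1) (While (ILess (ireg 4) (IMul (ireg 3) (ireg 1)))
      (Seq (Flip (IAdd (IConst 8) (ireg 4))) (ISet (IConst 4) (IAdd (ireg 4) (IConst 1))))) s
    (map_pmf (with_signs (m * d) (icell s 4) s) (coins r))"
  using assms
proof (induction r arbitrary: s)
  case 0
  have "with_signs (m * d) (icell s 4) s [] = s"
    using 0 by (auto simp: with_signs_def intro!: store.equality)
  then show ?case using 0 by (auto intro!: evaluates_return evaluates.halt)
next
  case (Suc r)
  let ?i = "icell s 4" and ?body = "Seq (Flip (IAdd (IConst 8) (ireg 4))) (ISet (IConst 4) (IAdd (ireg 4) (IConst 1)))"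
  let ?loop = "While (ILess (ireg 4) (IMul (ireg 3) (ireg 1))) ?body"
  let ?s = "\<lambda>b. s\<lparr>icell := (icell s)(8 + ?i := of_bool b)\<rparr>"
  let ?s' = "\<lambda>b. s\<lparr>icell := (icell s)(8 + ?i := of_bool b, 4 := Suc ?i)\<rparr>"
  have fit: "fits S (?s b)" for b
    using Suc.prems by (intro fits_ISet) auto
  have fit': "fits S (?s' b)" for b
    using fits_ISet[OF fit, of 4 "Suc ?i" b] Suc.prems by simp
  have "evaluates S (1 + 1 + 1) ?body s (bind_pmf (map_pmf ?s (bernoulli_pmf (1/2)))
      (\<lambda>s'. return_pmf (s'\<lparr>icell := (icell s')(4 := Suc ?i)\<rparr>)))"
    using Suc.prems evaluates_Flip[of S s "IAdd (IConst 8) (ireg 4)"] fit fit'[of True] fit'[of False]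
    by (intro evaluates_Seq) (auto intro!: evaluates_return evaluates.halt)
  then have "evaluates S (1 + 1 + 1) ?body s (map_pmf ?s' (bernoulli_pmf (1/2)))"
    by (simp add: map_pmf_def bind_assoc_pmf bind_return_pmf)
  then have "evaluates S ((1 + 1 + 1) + (r * 5 + 1) + 1) (Seq ?body ?loop) s
      (bind_pmf (map_pmf ?s' (bernoulli_pmf (1/2)))
        (\<lambda>s'. map_pmf (with_signs (m * d) (icell s' 4) s') (coins r)))"
    using Suc.prems fit' by (intro evaluates_Seq Suc.IH) auto
  \<comment> \<open>Writing one coin and then the rest equals writing the whole list: the list
    position of an address shifts by one at the head.\<close>
  also have "with_signs (m * d) (Suc ?i) (?s' b) bs = with_signs (m * d) ?i s (b # bs)" for b bs
  proof -
    have "a - 8 - ?i = Suc (a - 8 - Suc ?i)" if "8 + Suc ?i \<le> a" for a using that by simp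
    then show ?thesis using Suc.prems
      by (auto simp: with_signs_def fun_eq_iff nth_Cons' intro!: store.equality)
  qed
  then have "bind_pmf (map_pmf ?s' (bernoulli_pmf (1/2)))
        (\<lambda>s'. map_pmf (with_signs (m * d) (icell s' 4) s') (coins r)) =
      map_pmf (with_signs (m * d) ?i s) (coins (Suc r))"
    by (simp add: map_bind_pmf bind_map_pmf map_pmf_def bind_assoc_pmf bind_return_pmf)
  finally have *: "evaluates S ((1 + 1 + 1) + (r * 5 + 1) + 1) (Seq ?body ?loop) s
      (map_pmf (with_signs (m * d) ?i s) (coins (Suc r)))" .
  have "evaluates S (Suc ((1 + 1 + 1) + (r * 5 + 1) + 1)) ?loop s
      (map_pmf (with_signs (m * d) ?i s) (coins (Suc r)))"
    by (rule evaluates_return[OF _ _ _ *]) (use Suc.prems in auto)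
  then show ?case by (rule evaluates_mono) simp
qed

lemma evaluates_FlipSigns:
  assumes "fits S s" "icell s 3 = m" "icell s 1 = d" "8 + m * d < S"
  shows "evaluates S (m * d * 5 + 3) FlipSigns s (map_pmf (with_signs (m * d) 0 s) (coins (m * d)))"
proof -
  let ?s = "s\<lparr>icell := (icell s)(4 := 0)\<rparr>"
  let ?loop = "While (ILess (ireg 4) (IMul (ireg 3) (ireg 1)))
      (Seq (Flip (IAdd (IConst 8) (ireg 4))) (ISet (IConst 4) (IAdd (ireg 4) (IConst 1))))"
  have fit: "fits S ?s" using assms by (intro fits_ISet) auto
  have "evaluates S (1 + (m * d * 5 + 1) + 1) FlipSigns s
      (bind_pmf (return_pmf ?s) (\<lambda>s'. map_pmf (with_signs (m * d) 0 s') (coins (m * d))))"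
    unfolding FlipSigns_def For_def
  proof (rule evaluates_Seq)
    show "evaluates S 1 (ISet (IConst 4) (IConst 0)) s (return_pmf ?s)"
      using assms fit by (auto intro!: evaluates_return evaluates.halt)
    show "evaluates S (m * d * 5 + 1) ?loop s' (map_pmf (with_signs (m * d) 0 s') (coins (m * d)))"
      if "s' \<in> set_pmf (return_pmf ?s)" for s'
      using evaluates_FlipSigns_loop[of S s' m d "m * d"] that assms fit by simp
  qed
  moreover have "with_signs (m * d) 0 ?s = with_signs (m * d) 0 s"
    by (auto simp: with_signs_def fun_eq_iff)
  ultimately have "evaluates S (1 + (m * d * 5 + 1) + 1) FlipSigns s
      (map_pmf (with_signs (m * d) 0 s) (coins (m * d)))" by (simp add: bind_return_pmf)
  then show ?thesis by (rule evaluates_mono) simp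
qed

text \<open>The points are copied because the input buffer is replaced at the next operation; the
  offset 2 skips \<open>\<epsilon>\<close> and \<open>\<delta>\<close>.\<close>

definition LoadPoints :: com where
  "LoadPoints =
     Seq (For 4 (IMul (ireg 2) (ireg 1)) (RSet (IAdd (IConst 8) (ireg 4)) (RInput (IAdd (IConst 2) (ireg 4)))))
       (For 4 (ireg 2) (Sketch (OfflineSketchAddr (ireg 4))
          (RInput (IAdd (IConst 2) (IAdd (IMul (ireg 4) (ireg 1)) (ireg 6))))))"

lemma nth_concat_uniform:
  assumes "\<forall>x \<in> set xs. length x = d" "i < length xs" "k < d"
  shows "concat xs ! (i * d + k) = xs ! i ! k"
  using assms
proof (induction xs arbitrary: i)
  case (Cons x xs)
  then show ?case by (cases i) (auto simp: nth_append)
qed simp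

lemma length_concat_uniform: "\<forall>x \<in> set xs. length x = d \<Longrightarrow> length (concat xs) = length xs * d"
  by (induction xs) auto

lemma ensures_LoadPoints:
  assumes S: "8 + n + d + m + n * d + n * m + m * d < S"
    and xs: "length xs = n" "\<forall>x \<in> set xs. length x = d"
    and s: "prepared n d m \<epsilon> (init_store n d \<epsilon> \<delta> xs) s" "\<And>a. a < m * d \<Longrightarrow> icell s (8 + a) = of_bool (\<sigma> a)"
  shows "ensures S (n * d * 5 + n * (m * (5 * d + 11) + 7) + 8) LoadPoints s
    (represents n d m \<epsilon> \<sigma> xs (\<lambda>_. 0) 0)"
proof -
  let ?D = "8 + n * d + n + m"
  let ?J = "\<lambda>l s'. input s' = input s \<and> (\<forall>a. a \<noteq> 4 \<longrightarrow> icell s' a = icell s a) \<and>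
      (\<forall>a. a < 8 \<or> 8 + n * d \<le> a \<longrightarrow> rcell s' a = rcell s a) \<and> (\<forall>a<l. rcell s' (8 + a) = concat xs ! a)"
  let ?K = "\<lambda>l s'. input s' = input s \<and> (\<forall>a. a \<notin> {4, 5, 6} \<longrightarrow> icell s' a = icell s a) \<and>
      (\<forall>a. a \<noteq> 4 \<longrightarrow> a < 8 \<or> (8 + n * d \<le> a \<and> a < ?D) \<longrightarrow> rcell s' a = rcell s a) \<and>
      (\<forall>a<n * d. rcell s' (8 + a) = concat xs ! a) \<and>
      (\<forall>i<l. \<forall>j<m. rcell s' (?D + i * m + j) = sketch d \<sigma> ((!) (xs ! i)) j)"
  have inp: "input s (2 + a) = concat xs ! a" "input s (Suc (Suc a)) = concat xs ! a" if "a < n * d" for a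
    using s(1) that length_concat_uniform[OF xs(2)] xs(1)
    by (simp_all add: prepared_def init_store_def buffer_def)
  have pre: "icell s (Suc 0) = d" "icell s 2 = n" "icell s 3 = m"
    using s(1) by (auto simp: prepared_def)
  have "ensures S ((n * d * (1 + 4) + 3) + (n * ((m * (5 * d + 11) + 3) + 4) + 3) + 1) LoadPoints s
    (represents n d m \<epsilon> \<sigma> xs (\<lambda>_. 0) 0)"
    unfolding LoadPoints_def
  proof (rule ensures_Seq[where R = "?J (n * d)"], goal_cases)
    case 1
    show ?case
    proof (rule ensures_For[where I = ?J], goal_cases)
      case (5 l s1)
      then show ?case using S pre inp by (intro ensures_RSet) (auto simp: less_Suc_eq)
    qed (use S pre in auto)
  next
    case (2 s1)
    show ?case
    proof (rule ensures_For[where I = ?K], goal_cases)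
      case (5 i s2)
      have Si: "?D + i * m + m \<le> S"
      proof -
        have "Suc i * m \<le> n * m" using \<open>i < n\<close> by (intro mult_le_mono1) auto
        then show ?thesis using S by simp
      qed
      show ?case
      proof (rule ensures_Sketch[where D = "?D + i * m" and u = "(!) (xs ! i)" and \<sigma> = \<sigma> and d = d and m = m],
          goal_cases)
        case (10 s3 k)
        then show ?case using 5 pre inp[of "i * d + k"] index_less[of i n k d]
            nth_concat_uniform[of xs d i k] xs by (simp add: agree_except_def)
      next
        case (11 s3)
        \<comment> \<open>Sketches already written lie strictly below the block being
          written.\<close>
        have *: "?D + i' * m + j < ?D + i * m" if "i' < i" "j < m" for i' j
          using index_less[OF that] by simp
        have "\<forall>i'<i. \<forall>j<m. rcell s3 (?D + i' * m + j) = sketch d \<sigma> ((!) (xs ! i')) j"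
        proof (intro allI impI)
          fix i' j assume ij: "i' < i" "j < m"
          have "rcell s3 (?D + i' * m + j) = rcell s2 (?D + i' * m + j)"
            using *[OF ij] 11(1) by (simp add: agree_except_def)
          then show "rcell s3 (?D + i' * m + j) = sketch d \<sigma> ((!) (xs ! i')) j"
            using 5 ij by simp
        qed
        moreover have "\<forall>a<n * d. rcell s3 (8 + a) = concat xs ! a"
          using 5 11(1) by (auto simp: agree_except_def)
        ultimately show ?case using 5 11 by (auto simp: agree_except_def less_Suc_eq)
      qed (use S Si s(2) pre 5 in \<open>auto simp: agree_except_def\<close>)
    next
      case (6 s2)
      then show ?case
        using s pre xs nth_concat_uniform[of xs d] index_less[of _ n _ d]
        by (auto simp: represents_def prepared_def add.assoc)
    qed (use S pre 2 in auto)
  qed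
  then show ?thesis by (rule ensures_mono) (auto simp: algebra_simps)
qed

definition InitOp :: com where
  "InitOp = Seq Prepare (Seq FlipSigns LoadPoints)"

text \<open>Treats the random bits as a function of the memory, so that statements about later
  stores can refer to the matrix that was drawn.\<close>

definition signs :: "nat \<Rightarrow> store \<Rightarrow> bool list" where
  "signs N s = map (\<lambda>a. icell s (8 + a) = 1) [0..<N]"

text \<open>Used to show that an operation keeps the matrix: if the new store represents the old
  bits, reading them back yields the same list.\<close>

lemma signs_represents:
  "represents n d m \<epsilon> ((!) bs) xs v A s \<Longrightarrow> length bs = m * d \<Longrightarrow> signs (m * d) s = bs"
  by (rule nth_equalityI) (auto simp: represents_def signs_def)

text \<open>Loading is verified for each fixed matrix; the exact distribution has to be followed
  only through the coin flips.\<close>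

lemma evaluates_InitOp:
  assumes S: "8 + n + d + m + n * d + n * m + m * d < S"
    and xs: "length xs = n" "\<forall>x \<in> set xs. length x = d"
    and p: "0 < \<epsilon>" "0 < \<delta>" and m: "m = sketch_dim n \<epsilon> \<delta>"
  shows "\<exists>M. evaluates S (m * 5 + m * d * 5 + n * d * 5 + n * (m * (5 * d + 11) + 7) + 21) InitOp
      (init_store n d \<epsilon> \<delta> xs) M \<and>
    (\<forall>s \<in> set_pmf M. represents n d m \<epsilon> ((!) (signs (m * d) s)) xs (\<lambda>_. 0) 0 s) \<and>
    map_pmf (signs (m * d)) M = coins (m * d)"
proof -
  let ?init = "init_store n d \<epsilon> \<delta> xs" and ?N = "m * d"
  have "fits S ?init" using S by (auto simp: fits_def init_store_def)
  then obtain M where M: "evaluates S (m * 5 + 8) Prepare ?init M" "\<forall>s \<in> set_pmf M. prepared n d m \<epsilon> ?init s"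
    using ensures_Prepare[of S n m \<epsilon> \<delta> d xs] S p m unfolding ensures_def by auto
  let ?P = "\<lambda>s. fits S s \<and> prepared n d m \<epsilon> ?init s \<and> (\<forall>a<?N. icell s (8 + a) = of_bool (signs ?N s ! a))"
  have "\<exists>M'. evaluates S (n * d * 5 + n * (m * (5 * d + 11) + 7) + 8) LoadPoints s M' \<and>
      (\<forall>s' \<in> set_pmf M'. represents n d m \<epsilon> ((!) (signs ?N s)) xs (\<lambda>_. 0) 0 s')" if "?P s" for s
    using ensures_LoadPoints[OF S xs, of \<epsilon> \<delta> s "(!) (signs ?N s)"] that by (simp add: ensures_def)
  then obtain G where G:
    "\<And>s. ?P s \<Longrightarrow> evaluates S (n * d * 5 + n * (m * (5 * d + 11) + 7) + 8) LoadPoints s (G s)"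
    "\<And>s s'. ?P s \<Longrightarrow> s' \<in> set_pmf (G s) \<Longrightarrow> represents n d m \<epsilon> ((!) (signs ?N s)) xs (\<lambda>_. 0) 0 s'"
    by metis
  have signs_eq: "signs ?N s' = signs ?N s" if "?P s" "s' \<in> set_pmf (G s)" for s s'
    using G(2)[OF that] by (rule signs_represents) (simp add: signs_def)
  have with_signs: "signs ?N (with_signs ?N 0 s bs) = bs" if "bs \<in> set_pmf (coins ?N)" for s bs
    using length_coins[OF that] by (intro nth_equalityI) (auto simp: signs_def with_signs_def)
  have P: "?P (with_signs ?N 0 s bs)" if s: "s \<in> set_pmf M" and bs: "bs \<in> set_pmf (coins ?N)" for s bs
  proof -
    have pr: "prepared n d m \<epsilon> ?init s" and fit: "fits S s"
      using M s evaluates_fits_result by auto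
    have "fits S (with_signs ?N 0 s bs)"
      using fit S by (auto simp: fits_def with_signs_def)
    then show ?thesis
      using pr with_signs[OF bs] by (simp add: prepared_def with_signs_def)
  qed
  define M' where "M' = bind_pmf M (\<lambda>s. bind_pmf (map_pmf (with_signs ?N 0 s) (coins ?N)) G)"
  have "evaluates S ((m * 5 + 8) + ((m * d * 5 + 3) + (n * d * 5 + n * (m * (5 * d + 11) + 7) + 8) + 1) + 1)
      InitOp ?init M'"
    unfolding InitOp_def M'_def
  proof (intro evaluates_Seq evaluates_FlipSigns M(1))
    fix s assume s: "s \<in> set_pmf M"
    show "fits S s" using M(1) s by (rule evaluates_fits_result)
    show "icell s 3 = m" "icell s 1 = d" using M(2) s by (auto simp: prepared_def)
    show "evaluates S (n * d * 5 + n * (m * (5 * d + 11) + 7) + 8) LoadPoints s' (G s')"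
      if "s' \<in> set_pmf (map_pmf (with_signs ?N 0 s) (coins ?N))" for s'
      using that P[OF s] by (auto intro!: G(1) simp del: replicate_pmf.simps)
  qed (use S in simp)
  moreover have "represents n d m \<epsilon> ((!) (signs ?N s')) xs (\<lambda>_. 0) 0 s'" if "s' \<in> set_pmf M'" for s'
  proof -
    obtain s bs where *: "s \<in> set_pmf M" "bs \<in> set_pmf (coins ?N)" "s' \<in> set_pmf (G (with_signs ?N 0 s bs))"
      using \<open>s' \<in> set_pmf M'\<close> by (auto simp: M'_def)
    show ?thesis using G(2)[OF P[OF *(1,2)] *(3)] signs_eq[OF P[OF *(1,2)] *(3)] by simp
  qed
  moreover have "map_pmf (signs ?N) M' = coins ?N"
  proof -
    have "map_pmf (signs ?N) M' = bind_pmf M (\<lambda>s. bind_pmf (coins ?N)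
        (\<lambda>bs. map_pmf (signs ?N) (G (with_signs ?N 0 s bs))))"
      by (simp add: M'_def map_bind_pmf bind_map_pmf)
    \<comment> \<open>Loading keeps the matrix, so given the coins the inner distribution is
      concentrated on them.\<close>
    also have "\<dots> = bind_pmf M (\<lambda>s. bind_pmf (coins ?N) return_pmf)"
    proof (intro bind_pmf_cong refl)
      fix s bs assume *: "s \<in> set_pmf M" "bs \<in> set_pmf (coins ?N)"
      have "map_pmf (signs ?N) (G (with_signs ?N 0 s bs)) = map_pmf (\<lambda>_. bs) (G (with_signs ?N 0 s bs))"
        using signs_eq[OF P[OF *]] with_signs[OF *(2)] by (intro map_pmf_cong) auto
      then show "map_pmf (signs ?N) (G (with_signs ?N 0 s bs)) = return_pmf bs"
        by (simp add: map_pmf_const)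
    qed
    also have "\<dots> = coins ?N" by (simp add: bind_return_pmf')
    finally show ?thesis .
  qed
  ultimately show ?thesis by (auto simp: algebra_simps intro!: exI[of _ M'] elim!: evaluates_mono)
qed

section \<open>Sessions\<close>

lemma ensuresD:
  assumes "ensures S t c s Q" "fits S s"
  shows "halts_within t c s" "runs_in_space S c s"
    and "s' \<in> set_pmf (final c s) \<Longrightarrow> Q s'" "s' \<in> set_pmf (final c s) \<Longrightarrow> fits S s'"
proof -
  obtain M where M: "evaluates S t c s M" "\<forall>s' \<in> set_pmf M. Q s'"
    using assms by (auto simp: ensures_def)
  then show "halts_within t c s" "runs_in_space S c s"
    "s' \<in> set_pmf (final c s) \<Longrightarrow> Q s'" "s' \<in> set_pmf (final c s) \<Longrightarrow> fits S s'"
    using evaluates_halts evaluates_space evaluates_fits_result by (auto simp: evaluates_final)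
qed

text \<open>A query is \<open>Skip\<close> since the maintained value already sits in real cell 0,
  where answers are read.\<close>

definition sketch_matching :: data_structure where
  "sketch_matching = \<lparr>init_op = InitOp, update_op = UpdateOp, query_op = Skip\<rparr>"

definition update_time :: "nat \<Rightarrow> nat \<Rightarrow> nat \<Rightarrow> nat" where
  "update_time n d m = m * (5 * d + 11) + n * (m * 5 + 16) + d * 5 + 24"

definition init_time :: "nat \<Rightarrow> nat \<Rightarrow> nat \<Rightarrow> nat" where
  "init_time n d m = m * 5 + m * d * 5 + n * d * 5 + n * (m * (5 * d + 11) + 7) + 21"

definition memory_size :: "nat \<Rightarrow> nat \<Rightarrow> nat \<Rightarrow> nat" where
  "memory_size n d m = 9 + n + d + m + n * d + n * m + m * d"

text \<open>Only competitiveness is conditional, on the accuracy of the stored matrix for the points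
  seen so far. This carries a random event through an induction that is valid for every outcome of
  the coins.\<close>

definition session_inv ::
  "nat \<Rightarrow> nat \<Rightarrow> nat \<Rightarrow> real \<Rightarrow> real list list \<Rightarrow> real list list \<Rightarrow> nat list \<Rightarrow> store \<Rightarrow> bool" where
  "session_inv n d m \<epsilon> xs ys is s \<longleftrightarrow> fits (memory_size n d m) s \<and> length is = length ys \<and>
     represents n d m \<epsilon> ((!) (signs (m * d) s)) xs (share xs ys is) (matching_value xs ys is) s \<and>
     ((\<forall>x \<in> set xs. \<forall>y \<in> set ys. accurate d m \<epsilon> ((!) (signs (m * d) s)) x y) \<longrightarrow>
        competitive (max 0 (1 - 2 * \<epsilon>)) xs ys is)"

text \<open>\<open>session_inv\<close> contains \<open>fits\<close>, which the program rules do not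
  put into postconditions; hence the implication, whose premise \<open>ensuresD\<close> supplies
  later.\<close>

lemma ensures_update_session:
  assumes inv: "session_inv n d m \<epsilon> xs ys is s" and n: "0 < n"
    and xs: "length xs = n" "\<forall>x \<in> set xs. length x = d" and y: "length y = d"
  shows "ensures (memory_size n d m) (update_time n d m) UpdateOp (update_store y s)
    (\<lambda>s'. matched_index s' < n \<and> signs (m * d) s' = signs (m * d) s \<and>
      (fits (memory_size n d m) s' \<longrightarrow> session_inv n d m \<epsilon> xs (ys @ [y]) (is @ [matched_index s']) s'))"
  unfolding update_time_def
proof (rule ensures_UpdateOp[where \<sigma> = "(!) (signs (m * d) s)" and v = "share xs ys is"
      and A = "matching_value xs ys is" and xs = xs and y = y and \<epsilon> = \<epsilon>], goal_cases)
  case 5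
  then show ?case using inv by (simp add: session_inv_def represents_def update_store_def)
next
  case (8 s' b r)
  let ?bs = "signs (m * d) s" and ?v = "share xs ys is"
  have len: "length is = length ys" using inv by (simp add: session_inv_def)
  have signs: "signs (m * d) s' = ?bs"
    using 8(5) by (rule signs_represents) (simp add: signs_def)
  have share: "?v(b := max (?v b) (weight (xs ! b) y)) = share xs (ys @ [y]) (is @ [b])"
    using len by (simp add: share_snoc)
  have val: "matching_value xs ys is + (max (?v b) (weight (xs ! b) y) - ?v b) =
      matching_value xs (ys @ [y]) (is @ [b])"
    using len 8(2) xs by (simp add: matching_value_snoc)
  have "competitive (max 0 (1 - 2 * \<epsilon>)) xs (ys @ [y]) (is @ [b])"
    if acc: "\<forall>x \<in> set xs. \<forall>y \<in> set (ys @ [y]). accurate d m \<epsilon> ((!) ?bs) x y"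
  proof (rule competitive_snoc)
    show "competitive (max 0 (1 - 2 * \<epsilon>)) xs ys is" using inv acc by (simp add: session_inv_def)
    fix i assume i: "i < length xs"
    show "max 0 (1 - 2 * \<epsilon>) * weight (xs ! i) y \<le> ?v i + (max (?v b) (weight (xs ! b) y) - ?v b)"
      by (rule greedy_choice[where est = "\<lambda>i. estimate d m \<epsilon> ((!) ?bs) (xs ! i) y" and n = n and r = r])
         (use 8 acc xs i in \<open>auto simp: accurate_def\<close>)
  qed (use len 8 xs in auto)
  then show ?case
    using 8 len unfolding share val by (simp add: session_inv_def matched_index_def signs)
qed (use n xs y in \<open>auto simp: memory_size_def update_store_def\<close>)

lemma session_snoc: "session D n d \<epsilon> \<delta> xs (rs @ [r]) = bind_pmf (session D n d \<epsilon> \<delta> xs rs) (serve D r)"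
  by (simp add: session_def)

lemma online_points_append: "online_points (rs @ rs') = online_points rs @ online_points rs'"
  by (induction rs rule: online_points.induct) auto

lemma final_query: "final (query_op sketch_matching) (query_store s) = return_pmf (query_store s)"
  if "fits S s" for s
  using that by (intro evaluates_final[of S 0])
    (auto simp: sketch_matching_def query_store_def fits_def intro!: evaluates.halt)

text \<open>The first half describes every reachable store, the second the law of the stored matrix.
  The law persists because no request changes the matrix.\<close>

lemma session_invariant:
  assumes p: "(n, d, \<epsilon>, \<delta>) \<in> valid_params" and m: "m = sketch_dim n \<epsilon> \<delta>"
    and xs: "length xs = n" "\<forall>x \<in> set xs. length x = d"
    and rs: "\<forall>y \<in> set (online_points rs). length y = d"
  shows "(\<forall>(is, s) \<in> set_pmf (session sketch_matching n d \<epsilon> \<delta> xs rs).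
      session_inv n d m \<epsilon> xs (online_points rs) is s) \<and>
    map_pmf (signs (m * d) \<circ> snd) (session sketch_matching n d \<epsilon> \<delta> xs rs) = coins (m * d)"
  using rs
proof (induction rs rule: rev_induct)
  case Nil
  obtain M where M: "evaluates (memory_size n d m) (init_time n d m) InitOp (init_store n d \<epsilon> \<delta> xs) M"
    "\<forall>s \<in> set_pmf M. represents n d m \<epsilon> ((!) (signs (m * d) s)) xs (\<lambda>_. 0) 0 s"
    "map_pmf (signs (m * d)) M = coins (m * d)"
    using evaluates_InitOp[of n d m "memory_size n d m" xs \<epsilon> \<delta>] p m xs
    by (auto simp: memory_size_def init_time_def valid_params_def)
  have "session sketch_matching n d \<epsilon> \<delta> xs [] = map_pmf (\<lambda>s. ([], s)) M"
    using evaluates_final[OF M(1)] by (simp add: session_def sketch_matching_def)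
  moreover have "matching_value xs [] [] = 0" "share xs [] [] = (\<lambda>_. 0)"
    by (auto simp: matching_value_share share_Nil)
  ultimately show ?case
    using M evaluates_fits_result[OF M(1)]
    by (auto simp: session_inv_def competitive_Nil pmf.map_comp o_def)
next
  case (snoc r rs)
  let ?D = sketch_matching and ?N = "m * d" and ?ys = "online_points rs"
  have n: "0 < n" using p by (simp add: valid_params_def)
  have IH: "session_inv n d m \<epsilon> xs ?ys is s" if "(is, s) \<in> set_pmf (session ?D n d \<epsilon> \<delta> xs rs)" for "is" s
    using snoc that by (auto simp: online_points_append)
  have step: "session_inv n d m \<epsilon> xs (online_points (rs @ [r])) is' s' \<and> signs ?N s' = signs ?N s"
    if s: "(is, s) \<in> set_pmf (session ?D n d \<epsilon> \<delta> xs rs)" and s': "(is', s') \<in> set_pmf (serve ?D r (is, s))"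
    for "is" s is' s'
  proof (cases r)
    case (Update y)
    have y: "length y = d" using snoc.prems Update by (simp add: online_points_append)
    have s'_final: "s' \<in> set_pmf (final UpdateOp (update_store y s))" "is' = is @ [matched_index s']"
      using s' Update by (auto simp: sketch_matching_def)
    have "fits (memory_size n d m) (update_store y s)"
      using IH[OF s] by (simp add: session_inv_def fits_def update_store_def)
    note * = ensuresD(3,4)[OF ensures_update_session[OF IH[OF s] n xs y] this s'_final(1)]
    then show ?thesis using s'_final(2) Update by (simp add: online_points_append)
  next
    case Query
    have inv: "session_inv n d m \<epsilon> xs ?ys is s" by (rule IH[OF s])
    then have "fits (memory_size n d m) s" by (simp add: session_inv_def)
    then have "is' = is" "s' = query_store s" using s' Query by (auto simp: final_query)
    then show ?thesis using inv Query
      by (simp add: online_points_append session_inv_def query_store_def fits_def represents_def signs_def)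
  qed
  have "map_pmf (signs ?N \<circ> snd) (session ?D n d \<epsilon> \<delta> xs (rs @ [r])) =
      bind_pmf (session ?D n d \<epsilon> \<delta> xs rs) (\<lambda>p. map_pmf (signs ?N \<circ> snd) (serve ?D r p))"
    by (simp add: session_snoc map_bind_pmf)
  also have "\<dots> = bind_pmf (session ?D n d \<epsilon> \<delta> xs rs) (\<lambda>p. return_pmf (signs ?N (snd p)))"
  proof (rule bind_pmf_cong[OF refl])
    fix p assume p: "p \<in> set_pmf (session ?D n d \<epsilon> \<delta> xs rs)"
    have "map_pmf (signs ?N \<circ> snd) (serve ?D r p) = map_pmf (\<lambda>_. signs ?N (snd p)) (serve ?D r p)"
      using step[of "fst p" "snd p"] p by (intro map_pmf_cong) auto
    then show "map_pmf (signs ?N \<circ> snd) (serve ?D r p) = return_pmf (signs ?N (snd p))"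
      by (simp add: map_pmf_const)
  qed
  also have "\<dots> = map_pmf (signs ?N \<circ> snd) (session ?D n d \<epsilon> \<delta> xs rs)"
    by (simp add: map_pmf_def)
  also have "\<dots> = coins ?N" using snoc.IH snoc.prems by (simp add: online_points_append o_def)
  finally show ?case using step by (auto simp: session_snoc o_def)
qed

lemma query_answer_sketch_matching:
  "fits S s \<Longrightarrow> query_answer sketch_matching s = return_pmf (rcell s 0)"
  by (simp add: query_answer_def final_query) (simp add: answer_def query_store_def)

lemma session_inv_ratio:
  assumes inv: "session_inv n d m \<epsilon> xs ys is s" and n: "0 < n" "length xs = n"
    and acc: "\<forall>x \<in> set xs. \<forall>y \<in> set ys. accurate d m \<epsilon> ((!) (signs (m * d) s)) x y"
  shows "1 / 2 * (1 - 2 * \<epsilon>) * opt xs ys \<le> matching_value xs ys is"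
proof -
  have xs: "xs \<noteq> []" using n by auto
  have "competitive (max 0 (1 - 2 * \<epsilon>)) xs ys is" using inv acc by (simp add: session_inv_def)
  then have "max 0 (1 - 2 * \<epsilon>) * opt xs ys \<le> 2 * matching_value xs ys is"
    using xs by (intro competitive_ratio) auto
  \<comment> \<open>For \<open>\<epsilon>\<close> above 1/2 the left factor is negative, and the
    step rests on \<open>opt\<close> being nonnegative.\<close>
  moreover have "(1 - 2 * \<epsilon>) * opt xs ys \<le> max 0 (1 - 2 * \<epsilon>) * opt xs ys"
    using opt_nonneg[OF xs] by (intro mult_right_mono) auto
  ultimately show ?thesis by simp
qed

text \<open>The requests are fixed in advance, so the good matrices form a fixed set whose
  probability under the session is that under \<open>coins\<close>. At most \<open>n\<close> online
  points make the union bound match \<open>sketch_dim\<close>.\<close>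

lemma session_success:
  assumes p: "(n, d, \<epsilon>, \<delta>) \<in> valid_params" and xs: "length xs = n" "\<forall>x \<in> set xs. length x = d"
    and rs: "\<forall>y \<in> set (online_points rs). length y = d" "length (online_points rs) \<le> n"
  shows "1 - \<delta> \<le> measure_pmf.prob
      (bind_pmf (session sketch_matching n d \<epsilon> \<delta> xs rs) (\<lambda>(is, s). query_answer sketch_matching s))
      {v. v \<ge> (1 / 2) * (1 - 2 * \<epsilon>) * opt xs (online_points rs)}"
proof -
  define m where "m = sketch_dim n \<epsilon> \<delta>"
  let ?ys = "online_points rs" and ?N = "m * d" and ?Ses = "session sketch_matching n d \<epsilon> \<delta> xs rs"
  let ?ok = "{v. v \<ge> (1 / 2) * (1 - 2 * \<epsilon>) * opt xs ?ys}"
  let ?good = "{bs. \<forall>x \<in> set xs. \<forall>y \<in> set ?ys. accurate d m \<epsilon> ((!) bs) x y}"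
  have p': "1 \<le> n" "0 < \<epsilon>" "\<epsilon> < 1" "0 < \<delta>" "\<delta> < 1" using p by (auto simp: valid_params_def)
  note inv = session_invariant[OF p m_def xs rs(1)]
  have val: "rcell s 0 = matching_value xs ?ys is" "fits (memory_size n d m) s" if "(is, s) \<in> set_pmf ?Ses" for "is" s
    using inv that by (auto simp: session_inv_def represents_def)
  have "bind_pmf ?Ses (\<lambda>(is, s). query_answer sketch_matching s) = map_pmf (\<lambda>(is, s). rcell s 0) ?Ses"
    unfolding map_pmf_def using val(2)
    by (intro bind_pmf_cong) (auto intro!: query_answer_sketch_matching)
  then have "measure_pmf.prob (bind_pmf ?Ses (\<lambda>(is, s). query_answer sketch_matching s)) ?ok =
      measure_pmf.prob ?Ses ((\<lambda>(is, s). rcell s 0) -` ?ok)" by simp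
  moreover have "measure_pmf.prob ?Ses ((signs ?N \<circ> snd) -` ?good) \<le>
      measure_pmf.prob ?Ses ((\<lambda>(is, s). rcell s 0) -` ?ok)"
  proof (intro measure_pmf.finite_measure_mono_AE AE_pmfI impI)
    fix q assume q: "q \<in> set_pmf ?Ses" "q \<in> (signs ?N \<circ> snd) -` ?good"
    obtain "is" s where qs: "q = (is, s)" by fastforce
    have "1 / 2 * (1 - 2 * \<epsilon>) * opt xs ?ys \<le> matching_value xs ?ys is"
      using q inv p' xs unfolding qs by (intro session_inv_ratio[of n d m \<epsilon> xs ?ys "is" s]) auto
    then show "q \<in> (\<lambda>(is, s). rcell s 0) -` ?ok"
      using val(1)[of "is" s] q(1) by (simp add: qs)
  qed simp
  moreover have "measure_pmf.prob ?Ses ((signs ?N \<circ> snd) -` ?good) = measure_pmf.prob (coins ?N) ?good"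
    by (simp only: measure_map_pmf[symmetric] conjunct2[OF inv])
  moreover have "measure_pmf.prob (coins ?N) (- ?good) \<le> \<delta>"
  proof -
    let ?q = "(1 + \<epsilon>\<^sup>2 / 20) ^ m"
    have q: "0 < ?q" by (intro zero_less_power add_pos_nonneg) auto
    have "measure_pmf.prob (coins ?N) (- ?good) \<le> 2 * real n * real (length ?ys) / ?q"
      using accurate_failure[of \<epsilon> m xs d ?ys] p' xs sketch_dim_pos[of \<epsilon> \<delta> n]
      by (simp add: m_def flip: Collect_neg_eq)
    also have "\<dots> \<le> 2 * real n * real n / ?q"
      using rs(2) q by (intro divide_right_mono mult_left_mono) auto
    also have "\<dots> \<le> \<delta>"
      using sketch_dim(1)[of \<epsilon> \<delta> n] p' q by (simp add: m_def divide_le_eq mult_ac)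
    finally show ?thesis .
  qed
  moreover have "measure_pmf.prob (coins ?N) (- ?good) = 1 - measure_pmf.prob (coins ?N) ?good"
    using measure_pmf.prob_compl[of ?good "coins ?N"] by (simp add: Compl_eq_Diff_UNIV)
  ultimately show ?thesis by simp
qed

section \<open>Asymptotic resource bounds\<close>

lemma soft_OI:
  assumes "\<And>p. p \<in> regime \<Longrightarrow> real (t p) \<le> c * f p" "0 \<le> c"
  shows "(\<lambda>p. real (t p)) \<in> soft_O f"
proof -
  \<comment> \<open>Exponent 0 suffices: the bounds are plain multiples of \<open>f\<close>, with no
    further logarithmic factor.\<close>
  have "(\<lambda>p. real (t p)) \<in> O[principal regime](\<lambda>p. f p * ln (2 + f p) ^ 0)"
  proof (rule bigoI[where c = c], unfold eventually_principal, rule ballI)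
    fix p assume "p \<in> regime"
    then have "real (t p) \<le> c * f p" by (rule assms)
    also have "\<dots> \<le> c * \<bar>f p\<bar>" using assms(2) by (intro mult_left_mono) auto
    finally show "norm (real (t p)) \<le> c * norm (f p * ln (2 + f p) ^ 0)" by simp
  qed
  then show ?thesis unfolding soft_O_def by blast
qed

text \<open>15 and 59 are sums of coefficients, each monomial being at most
  \<open>m * n * d\<close>. For updates, \<open>5 * m * d\<close> and \<open>5 * m * n\<close>
  combine to \<open>5 * (m * (n + d))\<close>, and the remaining coefficients 11, 16, 5 and 24 bring
  this to 61.\<close>

lemma resource_bounds:
  fixes n d m :: nat
  assumes "1 \<le> n" "1 \<le> d" "1 \<le> m"
  shows "memory_size n d m \<le> 15 * (m * n * d)" "init_time n d m \<le> 59 * (m * n * d)"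
    "update_time n d m \<le> 61 * (m * (n + d))"
proof -
  obtain n' d' m' where "n = Suc n'" "d = Suc d'" "m = Suc m'"
    using assms by (metis Suc_le_D One_nat_def)
  then show "memory_size n d m \<le> 15 * (m * n * d)" "init_time n d m \<le> 59 * (m * n * d)"
    "update_time n d m \<le> 61 * (m * (n + d))"
    by (simp_all add: memory_size_def init_time_def update_time_def algebra_simps)
qed

lemma resource_soft_O:
  assumes "\<And>n d m. 1 \<le> n \<Longrightarrow> 1 \<le> d \<Longrightarrow> 1 \<le> m \<Longrightarrow> t n d m \<le> c * (m * g n d)"
  shows "(\<lambda>p. real (case p of (n, d, \<epsilon>, \<delta>) \<Rightarrow> t n d (sketch_dim n \<epsilon> \<delta>))) \<in>
    soft_O (\<lambda>(n, d, \<epsilon>, \<delta>). (1 / \<epsilon>^2) * real (g n d) * ln (real n / \<delta>))"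
proof (rule soft_OI[where c = "real c * 122"])
  fix p assume p: "p \<in> regime"
  obtain n d \<epsilon> \<delta> where eq: "p = (n, d, \<epsilon>, \<delta>)" by (cases p) auto
  let ?m = "sketch_dim n \<epsilon> \<delta>"
  have v: "1 \<le> n" "1 \<le> d" "0 < \<epsilon>" "0 < \<delta>" "\<delta> < 1" using p by (auto simp: eq regime_def valid_params_def)
  have "t n d ?m \<le> c * (?m * g n d)" using sketch_dim_pos[of \<epsilon> \<delta> n] v by (intro assms) auto
  then have "real (t n d ?m) \<le> real (c * (?m * g n d))" by (simp only: of_nat_le_iff)
  also have "\<dots> = real c * real (g n d) * real ?m" by simp
  also have "\<dots> \<le> real c * real (g n d) * (122 * (1 / \<epsilon>\<^sup>2 * ln (real n / \<delta>)))"
    using sketch_dim_le p by (intro mult_left_mono) (auto simp: eq)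
  finally show "real (case p of (n, d, \<epsilon>, \<delta>) \<Rightarrow> t n d (sketch_dim n \<epsilon> \<delta>)) \<le> real c * 122 *
      (case p of (n, d, \<epsilon>, \<delta>) \<Rightarrow> (1 / \<epsilon>^2) * real (g n d) * ln (real n / \<delta>))"
    by (simp add: eq mult_ac)
qed simp

theorem theorem5p1:
  shows "\<exists>(D :: data_structure) (T_init :: params \<Rightarrow> nat) (T_update :: params \<Rightarrow> nat)
           (T_query :: nat) (S :: params \<Rightarrow> nat).
    (\<lambda>p. real (S p)) \<in> soft_O (\<lambda>(n, d, \<epsilon>, \<delta>). (1 / \<epsilon>^2) * real n * real d * ln (real n / \<delta>)) \<and>
    (\<lambda>p. real (T_init p)) \<in> soft_O (\<lambda>(n, d, \<epsilon>, \<delta>). (1 / \<epsilon>^2) * real n * real d * ln (real n / \<delta>)) \<and>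
    (\<lambda>p. real (T_update p)) \<in> soft_O (\<lambda>(n, d, \<epsilon>, \<delta>). (1 / \<epsilon>^2) * (real n + real d) * ln (real n / \<delta>)) \<and>
    (\<forall>n d \<epsilon> \<delta> xs.
       (n, d, \<epsilon>, \<delta>) \<in> valid_params \<and> length xs = n \<and> (\<forall>x \<in> set xs. length x = d) \<longrightarrow>
         halts_within (T_init (n, d, \<epsilon>, \<delta>)) (init_op D) (init_store n d \<epsilon> \<delta> xs) \<and>
         runs_in_space (S (n, d, \<epsilon>, \<delta>)) (init_op D) (init_store n d \<epsilon> \<delta> xs) \<and>
         (\<forall>rs. (\<forall>y \<in> set (online_points rs). length y = d) \<longrightarrow>
            (\<forall>(is, s) \<in> set_pmf (session D n d \<epsilon> \<delta> xs rs).
               (\<forall>y. length y = d \<longrightarrow>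
                  halts_within (T_update (n, d, \<epsilon>, \<delta>)) (update_op D) (update_store y s) \<and>
                  runs_in_space (S (n, d, \<epsilon>, \<delta>)) (update_op D) (update_store y s) \<and>
                  (\<forall>s' \<in> set_pmf (final (update_op D) (update_store y s)). matched_index s' < n)) \<and>
               halts_within T_query (query_op D) (query_store s) \<and>
               runs_in_space (S (n, d, \<epsilon>, \<delta>)) (query_op D) (query_store s) \<and>
               (\<forall>v \<in> set_pmf (query_answer D s). v = matching_value xs (online_points rs) is)) \<and>
            (length (online_points rs) \<le> n \<longrightarrow>
               measure_pmf.prob
                 (bind_pmf (session D n d \<epsilon> \<delta> xs rs) (\<lambda>(is, s). query_answer D s))
                 {v. v \<ge> (1 / 2) * (1 - 2 * \<epsilon>) * opt xs (online_points rs)} \<ge> 1 - \<delta>)))"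
proof (intro exI conjI)
  \<comment> \<open>The witnesses are explicit functions of \<open>n\<close>, \<open>d\<close> and
    \<open>sketch_dim\<close>, valid for all admissible parameters; only their O-estimates are
    confined to \<open>regime\<close>.\<close>
  let ?dim = "\<lambda>f (n, d, \<epsilon>, \<delta>). f n d (sketch_dim n \<epsilon> \<delta>) :: nat"
  show "(\<lambda>p. real (?dim memory_size p)) \<in>
      soft_O (\<lambda>(n, d, \<epsilon>, \<delta>). (1 / \<epsilon>^2) * real n * real d * ln (real n / \<delta>))"
    "(\<lambda>p. real (?dim init_time p)) \<in>
      soft_O (\<lambda>(n, d, \<epsilon>, \<delta>). (1 / \<epsilon>^2) * real n * real d * ln (real n / \<delta>))"
    "(\<lambda>p. real (?dim update_time p)) \<in>
      soft_O (\<lambda>(n, d, \<epsilon>, \<delta>). (1 / \<epsilon>^2) * (real n + real d) * ln (real n / \<delta>))"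
    using resource_soft_O[of memory_size 15 "\<lambda>n d. n * d"] resource_soft_O[of init_time 59 "\<lambda>n d. n * d"]
      resource_soft_O[of update_time 61 "\<lambda>n d. n + d"] resource_bounds
    by (simp_all add: mult.assoc)
  show "\<forall>n d \<epsilon> \<delta> xs.
       (n, d, \<epsilon>, \<delta>) \<in> valid_params \<and> length xs = n \<and> (\<forall>x \<in> set xs. length x = d) \<longrightarrow>
         halts_within (?dim init_time (n, d, \<epsilon>, \<delta>)) (init_op sketch_matching) (init_store n d \<epsilon> \<delta> xs) \<and>
         runs_in_space (?dim memory_size (n, d, \<epsilon>, \<delta>)) (init_op sketch_matching) (init_store n d \<epsilon> \<delta> xs) \<and>
         (\<forall>rs. (\<forall>y \<in> set (online_points rs). length y = d) \<longrightarrow>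
            (\<forall>(is, s) \<in> set_pmf (session sketch_matching n d \<epsilon> \<delta> xs rs).
               (\<forall>y. length y = d \<longrightarrow>
                  halts_within (?dim update_time (n, d, \<epsilon>, \<delta>)) (update_op sketch_matching) (update_store y s) \<and>
                  runs_in_space (?dim memory_size (n, d, \<epsilon>, \<delta>)) (update_op sketch_matching) (update_store y s) \<and>
                  (\<forall>s' \<in> set_pmf (final (update_op sketch_matching) (update_store y s)). matched_index s' < n)) \<and>
               halts_within 0 (query_op sketch_matching) (query_store s) \<and>
               runs_in_space (?dim memory_size (n, d, \<epsilon>, \<delta>)) (query_op sketch_matching) (query_store s) \<and>
               (\<forall>v \<in> set_pmf (query_answer sketch_matching s). v = matching_value xs (online_points rs) is)) \<and>
            (length (online_points rs) \<le> n \<longrightarrow>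
               measure_pmf.prob
                 (bind_pmf (session sketch_matching n d \<epsilon> \<delta> xs rs) (\<lambda>(is, s). query_answer sketch_matching s))
                 {v. v \<ge> (1 / 2) * (1 - 2 * \<epsilon>) * opt xs (online_points rs)} \<ge> 1 - \<delta>))"
  proof (intro allI impI, goal_cases)
    case (1 n d \<epsilon> \<delta> xs)
    define m where "m = sketch_dim n \<epsilon> \<delta>"
    have p: "(n, d, \<epsilon>, \<delta>) \<in> valid_params" and xs: "length xs = n" "\<forall>x \<in> set xs. length x = d"
      using 1 by auto
    have n: "0 < n" using p by (simp add: valid_params_def)
    obtain M where init: "evaluates (memory_size n d m) (init_time n d m) InitOp (init_store n d \<epsilon> \<delta> xs) M"
      using evaluates_InitOp[of n d m "memory_size n d m" xs \<epsilon> \<delta>] p xs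
      by (auto simp: m_def memory_size_def init_time_def valid_params_def)
    have update: "halts_within (update_time n d m) UpdateOp (update_store y s)"
      "runs_in_space (memory_size n d m) UpdateOp (update_store y s)"
      "\<forall>s' \<in> set_pmf (final UpdateOp (update_store y s)). matched_index s' < n"
      if "session_inv n d m \<epsilon> xs ys is s" "length y = d" for ys "is" s y
    proof -
      have "fits (memory_size n d m) (update_store y s)"
        using that by (simp add: session_inv_def fits_def update_store_def)
      note * = ensuresD[OF ensures_update_session[OF that(1) n xs that(2)] this]
      show "halts_within (update_time n d m) UpdateOp (update_store y s)"
        "runs_in_space (memory_size n d m) UpdateOp (update_store y s)"
        "\<forall>s' \<in> set_pmf (final UpdateOp (update_store y s)). matched_index s' < n"
        using * by auto
    qed
    have query: "halts_within 0 Skip (query_store s)" "runs_in_space (memory_size n d m) Skip (query_store s)"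
      "\<forall>v \<in> set_pmf (query_answer sketch_matching s). v = matching_value xs ys is"
      if "session_inv n d m \<epsilon> xs ys is s" for ys "is" s
    proof -
      have fit: "fits (memory_size n d m) s" and val: "rcell s 0 = matching_value xs ys is"
        using that by (auto simp: session_inv_def represents_def)
      have "evaluates (memory_size n d m) 0 Skip (query_store s) (return_pmf (query_store s))"
        using fit by (intro evaluates.halt) (simp add: fits_def query_store_def)
      then show "halts_within 0 Skip (query_store s)" "runs_in_space (memory_size n d m) Skip (query_store s)"
        by (rule evaluates_halts, rule evaluates_space)
      show "\<forall>v \<in> set_pmf (query_answer sketch_matching s). v = matching_value xs ys is"
        using fit val by (simp add: query_answer_sketch_matching)
    qed
    have ops: "init_op sketch_matching = InitOp" "update_op sketch_matching = UpdateOp"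
      "query_op sketch_matching = Skip"
      by (simp_all add: sketch_matching_def)
    show ?case
      unfolding prod.case ops m_def[symmetric]
    proof (intro conjI allI impI)
      fix rs assume rs: "\<forall>y \<in> set (online_points rs). length y = d"
      show "\<forall>(is, s) \<in> set_pmf (session sketch_matching n d \<epsilon> \<delta> xs rs).
        (\<forall>y. length y = d \<longrightarrow> halts_within (update_time n d m) UpdateOp (update_store y s) \<and>
          runs_in_space (memory_size n d m) UpdateOp (update_store y s) \<and>
          (\<forall>s' \<in> set_pmf (final UpdateOp (update_store y s)). matched_index s' < n)) \<and>
        halts_within 0 Skip (query_store s) \<and> runs_in_space (memory_size n d m) Skip (query_store s) \<and>
        (\<forall>v \<in> set_pmf (query_answer sketch_matching s). v = matching_value xs (online_points rs) is)"
      proof clarify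
        fix "is" s assume "(is, s) \<in> set_pmf (session sketch_matching n d \<epsilon> \<delta> xs rs)"
        then have "session_inv n d m \<epsilon> xs (online_points rs) is s"
          using session_invariant[OF p m_def xs rs] by auto
        note * = update[OF this] query[OF this]
        show "(\<forall>y. length y = d \<longrightarrow> halts_within (update_time n d m) UpdateOp (update_store y s) \<and>
            runs_in_space (memory_size n d m) UpdateOp (update_store y s) \<and>
            (\<forall>s' \<in> set_pmf (final UpdateOp (update_store y s)). matched_index s' < n)) \<and>
          halts_within 0 Skip (query_store s) \<and> runs_in_space (memory_size n d m) Skip (query_store s) \<and>
          (\<forall>v \<in> set_pmf (query_answer sketch_matching s). v = matching_value xs (online_points rs) is)"
          using * by blast
      qed
    qed (use evaluates_halts[OF init] evaluates_space[OF init] session_success[OF p xs] in auto)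
  qed
qed

end
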